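(* Let $f\in C^3(\mathbb{T})$ be a non-constant real-valued function. Let $V\in C^1(A_{f'})\cap C^1(X)\cap C^1(X^2)$ be a bounded symmetric operator on $l^2(\mathbb{N})$, and let $H=T_f+V$. Then, for all $\varphi\in\mathcal{D}_X$ and for each of the limits $t\to+\infty$ and $t\to-\infty$, $$\limsup_{t\to\pm\infty}\frac{1}{|t|}\|e^{iHt}\varphi\|_X\le\sqrt{\|\mathrm{ad}_{A_{f'}}H\|}\,\|\varphi\|.$$
   Context: $\mathbb{N}=\{1,2,3,\dots\}$, $\mathbb{T}=\mathbb{R}/2\pi\mathbb{Z}$, and $(e_n)_{n\in\mathbb{N}}$ is the canonical orthonormal basis of the complex Hilbert space $l^2(\mathbb{N})$. For $f\in L^\infty(\mathbb{T})$, $\hat f_n=\frac{1}{2\pi}\int_{\mathbb{T}}e^{-in\theta}f(\theta)\,d\theta$, and the Toeplitz operator $T_f$ is the bounded operator on $l^2(\mathbb{N})$ given by $(T_f\varphi)_n=\sum_{k\in\mathbb{N}}\hat f_{n-k}\varphi_k$. $X$ is the self-adjoint position operator $Xe_n=ne_n$ with domain $\mathcal{D}_X=\{\psi\in l^2(\mathbb{N}):\sum_n n^2|\psi_n|^2<\infty\}$, and $\|\psi\|_X=\sqrt{\|\psi\|^2+\|X\psi\|^2}$ for $\psi\in\mathcal{D}_X$. For real-valued $g\in C^2(\mathbb{T})$, one has $T_g\mathcal{D}_X\subset\mathcal{D}_X$, and the symmetric operator $\frac12(T_gX+XT_g)$ with domain $\mathcal{D}_X$ is essentially self-adjoint; $A_g$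 denotes its self-adjoint closure. For a self-adjoint operator $A$ with domain $\mathcal{D}(A)$ and a bounded operator $B$ on a Hilbert space, $B\in C^1(A)$ means that the sesquilinear form $(\varphi,\psi)\mapsto\langle A\varphi,B\psi\rangle-\langle\varphi,BA\psi\rangle$ on $\mathcal{D}(A)\times\mathcal{D}(A)$ extends to a bounded form on the whole space; the associated bounded operator is denoted $\mathrm{ad}_AB=[A,B]$. One has $T_f\in C^1(A_{f'})\cap C^1(X)$, so $H\in C^1(A_{f'})\cap C^1(X)$ and $e^{iHt}\mathcal{D}_X\subset\mathcal{D}_X$. *)

theory Defs
  imports "HOL-Analysis.Analysis"
begin

section \<open>The complex Hilbert space $l^2(\mathbf{N})$, $\mathbf{N} = \{1,2,3,\dots\}$\<close>

text \<open>Indices start at 1: the unused coordinate 0 of a sequence is required to vanish.\<close>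

typedef l2 = "{\<psi> :: nat \<Rightarrow> complex. \<psi> 0 = 0 \<and> summable (\<lambda>n. (cmod (\<psi> n))\<^sup>2)}"
  morphisms coord Abs_l2
  by (rule exI[of _ "\<lambda>_. 0"]) simp

setup_lifting type_definition_l2

lemma coord_0 [simp]: "coord \<psi> 0 = 0"
  using coord[of \<psi>] by simp

lemma summable_coord: "summable (\<lambda>n. (cmod (coord \<psi> n))\<^sup>2)"
  using coord[of \<psi>] by simp

lemma l2_eqI: "(\<And>n. coord \<phi> n = coord \<psi> n) \<Longrightarrow> \<phi> = \<psi>"
  by (simp add: coord_inject[symmetric] fun_eq_iff)

lemma cmod_add_sq_le: "(cmod (a + b))\<^sup>2 \<le> 2 * (cmod a)\<^sup>2 + 2 * (cmod b)\<^sup>2"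
proof -
  have "(cmod (a + b))\<^sup>2 \<le> (cmod a + cmod b)\<^sup>2"
    by (simp add: norm_triangle_ineq power_mono)
  also have "\<dots> \<le> 2 * (cmod a)\<^sup>2 + 2 * (cmod b)\<^sup>2"
    using sum_squares_bound[of "cmod a" "cmod b"] by (simp add: power2_sum)
  finally show ?thesis .
qed

lemma summable_sq_add:
  fixes f g :: "nat \<Rightarrow> complex"
  assumes "summable (\<lambda>n. (cmod (f n))\<^sup>2)" "summable (\<lambda>n. (cmod (g n))\<^sup>2)"
  shows "summable (\<lambda>n. (cmod (f n + g n))\<^sup>2)"
proof (rule summable_comparison_test)
  show "\<exists>N. \<forall>n\<ge>N. norm ((cmod (f n + g n))\<^sup>2) \<le> 2 * (cmod (f n))\<^sup>2 + 2 * (cmod (g n))\<^sup>2"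
    by (simp add: cmod_add_sq_le)
  show "summable (\<lambda>n. 2 * (cmod (f n))\<^sup>2 + 2 * (cmod (g n))\<^sup>2)"
    using assms by (intro summable_add summable_mult)
qed

lift_definition scaleC_l2 :: "complex \<Rightarrow> l2 \<Rightarrow> l2" (infixr \<open>*\<^sub>C\<close> 75)
  is "\<lambda>c \<psi> n. c * \<psi> n"
  by (simp add: norm_mult power_mult_distrib summable_mult)

definition cinner :: "l2 \<Rightarrow> l2 \<Rightarrow> complex"
  where "cinner \<phi> \<psi> = (\<Sum>n. cnj (coord \<phi> n) * coord \<psi> n)"

lemma summable_cinner: "summable (\<lambda>n. cnj (coord \<phi> n) * coord \<psi> n)"
proof (rule summable_norm_cancel, rule summable_comparison_test)
  show "\<exists>N. \<forall>n\<ge>N. norm (norm (cnj (coord \<phi> n) * coord \<psi> n))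
      \<le> (cmod (coord \<phi> n))\<^sup>2 + (cmod (coord \<psi> n))\<^sup>2"
  proof (intro exI allI impI)
    fix n
    have "2 * (cmod (coord \<phi> n) * cmod (coord \<psi> n))
        \<le> (cmod (coord \<phi> n))\<^sup>2 + (cmod (coord \<psi> n))\<^sup>2"
      using sum_squares_bound[of "cmod (coord \<phi> n)" "cmod (coord \<psi> n)"] by simp
    moreover have "0 \<le> cmod (coord \<phi> n) * cmod (coord \<psi> n)" by simp
    ultimately have "cmod (coord \<phi> n) * cmod (coord \<psi> n)
        \<le> (cmod (coord \<phi> n))\<^sup>2 + (cmod (coord \<psi> n))\<^sup>2" by linarith
    then show "norm (norm (cnj (coord \<phi> n) * coord \<psi> n))
      \<le> (cmod (coord \<phi> n))\<^sup>2 + (cmod (coord \<psi> n))\<^sup>2"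
      by (simp add: norm_mult)
  qed
  show "summable (\<lambda>n. (cmod (coord \<phi> n))\<^sup>2 + (cmod (coord \<psi> n))\<^sup>2)"
    by (intro summable_add summable_coord)
qed

instantiation l2 :: real_vector
begin

lift_definition zero_l2 :: l2 is "\<lambda>_. 0" by simp

lift_definition plus_l2 :: "l2 \<Rightarrow> l2 \<Rightarrow> l2" is "\<lambda>\<phi> \<psi> n. \<phi> n + \<psi> n"
  by (simp add: summable_sq_add)

lift_definition uminus_l2 :: "l2 \<Rightarrow> l2" is "\<lambda>\<psi> n. - \<psi> n" by simp

lift_definition minus_l2 :: "l2 \<Rightarrow> l2 \<Rightarrow> l2" is "\<lambda>\<phi> \<psi> n. \<phi> n - \<psi> n"
  subgoal for \<phi> \<psi> using summable_sq_add[of \<phi> "\<lambda>n. - \<psi> n"] by simp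
  done

lift_definition scaleR_l2 :: "real \<Rightarrow> l2 \<Rightarrow> l2" is "\<lambda>r \<psi> n. r *\<^sub>R \<psi> n"
  by (simp add: power_mult_distrib summable_mult)

instance
proof
  fix x y z :: l2 and r s :: real
  show "x + y + z = x + (y + z)" by transfer (simp add: add.assoc)
  show "x + y = y + x" by transfer (simp add: add.commute)
  show "0 + x = x" by transfer simp
  show "- x + x = 0" by transfer simp
  show "x - y = x + - y" by transfer simp
  show "r *\<^sub>R (x + y) = r *\<^sub>R x + r *\<^sub>R y" by transfer (simp add: scaleR_add_right)
  show "(r + s) *\<^sub>R x = r *\<^sub>R x + s *\<^sub>R x" by transfer (simp add: scaleR_add_left)
  show "r *\<^sub>R s *\<^sub>R x = (r * s) *\<^sub>R x" by transfer simp
  show "1 *\<^sub>R x = x" by transfer simp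
qed

end

instantiation l2 :: real_inner
begin

definition inner_l2 :: "l2 \<Rightarrow> l2 \<Rightarrow> real"
  where "inner_l2 \<phi> \<psi> = Re (cinner \<phi> \<psi>)"

definition norm_l2 :: "l2 \<Rightarrow> real"
  where "norm_l2 \<psi> = sqrt (\<Sum>n. (cmod (coord \<psi> n))\<^sup>2)"

definition dist_l2 :: "l2 \<Rightarrow> l2 \<Rightarrow> real"
  where "dist_l2 \<phi> \<psi> = norm (\<phi> - \<psi>)"

definition sgn_l2 :: "l2 \<Rightarrow> l2"
  where "sgn_l2 \<psi> = \<psi> /\<^sub>R norm \<psi>"

definition uniformity_l2 :: "(l2 \<times> l2) filter"
  where "uniformity_l2 = (INF e\<in>{0<..}. principal {(\<phi>, \<psi>). dist \<phi> \<psi> < e})"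

definition open_l2 :: "l2 set \<Rightarrow> bool"
  where "open_l2 U = (\<forall>x\<in>U. eventually (\<lambda>(x', y). x' = x \<longrightarrow> y \<in> U) uniformity)"

instance
proof
  show "dist x y = norm (x - y)" for x y :: l2 by (rule dist_l2_def)
  show "sgn x = x /\<^sub>R norm x" for x :: l2 by (rule sgn_l2_def)
  show "uniformity = (INF e\<in>{0<..}. principal {(x, y :: l2). dist x y < e})"
    by (rule uniformity_l2_def)
  show "open U = (\<forall>x\<in>U. eventually (\<lambda>(x', y). x' = x \<longrightarrow> y \<in> U) uniformity)" for U :: "l2 set"
    by (rule open_l2_def)
  fix x y z :: l2 and r :: real
  have inner_eq: "inner x y = (\<Sum>n. Re (cnj (coord x n) * coord y n))" for x y :: l2
    unfolding inner_l2_def cinner_def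
    by (rule sums_unique, rule sums_Re, rule summable_sums, rule summable_cinner)
  have sm: "summable (\<lambda>n. Re (cnj (coord x n) * coord y n))" for x y
    by (rule summable_Re[OF summable_cinner])
  show "inner x y = inner y x" unfolding inner_eq by (simp add: mult.commute)
  show "inner (x + y) z = inner x z + inner y z"
    unfolding inner_eq suminf_add[OF sm sm]
    by (simp add: plus_l2.rep_eq algebra_simps)
  show "inner (r *\<^sub>R x) y = r * inner x y"
    unfolding inner_eq suminf_mult[OF sm, symmetric]
    by (simp add: scaleR_l2.rep_eq algebra_simps)
  have Re_eq: "Re (cnj (coord x n) * coord x n) = (cmod (coord x n))\<^sup>2" for x n
    unfolding cmod_power2 by (simp add: power2_eq_square)
  have self: "inner x x = (\<Sum>n. (cmod (coord x n))\<^sup>2)" for x :: l2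
    unfolding inner_eq Re_eq ..
  show "0 \<le> inner x x" unfolding self by (rule suminf_nonneg[OF summable_coord]) simp
  show "(inner x x = 0) = (x = 0)"
    unfolding self suminf_eq_zero_iff[OF summable_coord zero_le_power2]
    by (auto intro!: l2_eqI simp: zero_l2.rep_eq)
  show "norm x = sqrt (inner x x)" unfolding self norm_l2_def ..
qed

end

lemma cmod_coord_le_norm: "cmod (coord \<psi> n) \<le> norm \<psi>"
proof -
  have "(cmod (coord \<psi> n))\<^sup>2 \<le> (\<Sum>n. (cmod (coord \<psi> n))\<^sup>2)"
    using sum_le_suminf[OF summable_coord, of "{n}" \<psi>] by simp
  then show ?thesis unfolding norm_l2_def by (rule real_le_rsqrt)
qed

instance l2 :: complete_space
proof
  fix S :: "nat \<Rightarrow> l2"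
  assume "Cauchy S"
  have coord_diff: "coord (\<phi> - \<psi>) n = coord \<phi> n - coord \<psi> n" for \<phi> \<psi> n
    by (simp add: minus_l2.rep_eq)
  have "Cauchy (\<lambda>k. coord (S k) n)" for n
    unfolding Cauchy_def
  proof (intro allI impI)
    fix e :: real assume "e > 0"
    then obtain M where M: "\<And>j k. j \<ge> M \<Longrightarrow> k \<ge> M \<Longrightarrow> dist (S j) (S k) < e"
      using \<open>Cauchy S\<close> unfolding Cauchy_def by blast
    have "dist (coord (S j) n) (coord (S k) n) < e" if "j \<ge> M" "k \<ge> M" for j k
      using cmod_coord_le_norm[of "S j - S k" n] M[OF that]
      by (simp add: dist_norm coord_diff)
    then show "\<exists>M. \<forall>j\<ge>M. \<forall>k\<ge>M. dist (coord (S j) n) (coord (S k) n) < e" by blast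
  qed
  then obtain l where l: "\<And>n. (\<lambda>k. coord (S k) n) \<longlonglongrightarrow> l n"
    unfolding Cauchy_convergent_iff convergent_def by metis
  have l0: "l 0 = 0" using l[of 0] by (simp add: LIMSEQ_const_iff)
  have tail: "\<exists>M. \<forall>j\<ge>M. summable (\<lambda>n. (cmod (coord (S j) n - l n))\<^sup>2)
      \<and> (\<Sum>n. (cmod (coord (S j) n - l n))\<^sup>2) \<le> e\<^sup>2" if "e > 0" for e :: real
  proof -
    obtain M where M: "\<And>j k. j \<ge> M \<Longrightarrow> k \<ge> M \<Longrightarrow> dist (S j) (S k) < e"
      using \<open>Cauchy S\<close> \<open>e > 0\<close> unfolding Cauchy_def by blast
    have part: "(\<Sum>n<N. (cmod (coord (S j) n - l n))\<^sup>2) \<le> e\<^sup>2" if "j \<ge> M" for j N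
    proof (rule LIMSEQ_le_const2)
      show "(\<lambda>k. \<Sum>n<N. (cmod (coord (S j) n - coord (S k) n))\<^sup>2)
          \<longlonglongrightarrow> (\<Sum>n<N. (cmod (coord (S j) n - l n))\<^sup>2)"
        by (intro tendsto_intros l)
      have "(\<Sum>n<N. (cmod (coord (S j) n - coord (S k) n))\<^sup>2) \<le> e\<^sup>2" if "k \<ge> M" for k
      proof -
        have "(\<Sum>n<N. (cmod (coord (S j - S k) n))\<^sup>2) \<le> (\<Sum>n. (cmod (coord (S j - S k) n))\<^sup>2)"
          by (rule sum_le_suminf[OF summable_coord]) auto
        also have "\<dots> = (norm (S j - S k))\<^sup>2"
          unfolding norm_l2_def
          by (subst real_sqrt_pow2) (auto intro: suminf_nonneg[OF summable_coord])
        also have "\<dots> \<le> e\<^sup>2"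
          using M[OF \<open>j \<ge> M\<close> \<open>k \<ge> M\<close>] by (simp add: dist_norm power_mono)
        finally show ?thesis by (simp add: coord_diff)
      qed
      then show "\<exists>K. \<forall>k\<ge>K. (\<Sum>n<N. (cmod (coord (S j) n - coord (S k) n))\<^sup>2) \<le> e\<^sup>2" by blast
    qed
    have "summable (\<lambda>n. (cmod (coord (S j) n - l n))\<^sup>2)
      \<and> (\<Sum>n. (cmod (coord (S j) n - l n))\<^sup>2) \<le> e\<^sup>2" if "j \<ge> M" for j
    proof -
      have "summable (\<lambda>n. (cmod (coord (S j) n - l n))\<^sup>2)"
        using part[OF that] by (intro summableI_nonneg_bounded[where x = "e\<^sup>2"]) auto
      then show ?thesis using part[OF that] by (auto intro: suminf_le_const)
    qed
    then show ?thesis by blast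
  qed
  obtain M where M: "summable (\<lambda>n. (cmod (coord (S M) n - l n))\<^sup>2)"
    using tail[of 1] by auto
  have "summable (\<lambda>n. (cmod (l n))\<^sup>2)"
    using summable_sq_add[OF summable_coord[of "S M"], of "\<lambda>n. l n - coord (S M) n"] M
    by (simp add: norm_minus_commute)
  then have cl: "coord (Abs_l2 l) = l" using l0 by (simp add: Abs_l2_inverse)
  have "S \<longlonglongrightarrow> Abs_l2 l"
  proof (rule metric_LIMSEQ_I)
    fix e :: real assume "e > 0"
    then obtain M where M: "\<forall>j\<ge>M. (\<Sum>n. (cmod (coord (S j) n - l n))\<^sup>2) \<le> (e / 2)\<^sup>2"
      using tail[of "e / 2"] by auto
    have "dist (S j) (Abs_l2 l) < e" if "j \<ge> M" for j
    proof -
      have "norm (S j - Abs_l2 l) \<le> e / 2"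
        unfolding norm_l2_def coord_diff cl using M that \<open>e > 0\<close>
        by (intro real_le_lsqrt) auto
      then show ?thesis using \<open>e > 0\<close> by (simp add: dist_norm)
    qed
    then show "\<exists>M. \<forall>j\<ge>M. dist (S j) (Abs_l2 l) < e" by blast
  qed
  then show "convergent S" unfolding convergent_def by blast
qed


section \<open>Operators\<close>

text \<open>\<open>onorm\<close> of such a map is its operator norm.\<close>

definition bounded_clinear :: "(l2 \<Rightarrow> l2) \<Rightarrow> bool"
  where "bounded_clinear B \<longleftrightarrow> bounded_linear B \<and> (\<forall>c \<psi>. B (c *\<^sub>C \<psi>) = c *\<^sub>C B \<psi>)"

definition symmetric_op :: "(l2 \<Rightarrow> l2) \<Rightarrow> bool"
  where "symmetric_op B \<longleftrightarrow> (\<forall>\<phi> \<psi>. cinner (B \<phi>) \<psi> = cinner \<phi> (B \<psi>))"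

definition op_exp :: "(l2 \<Rightarrow> l2) \<Rightarrow> l2 \<Rightarrow> l2"
  where "op_exp B \<psi> = (\<Sum>k. (B ^^ k) \<psi> /\<^sub>R fact k)"

definition bounded_sesquilinear :: "(l2 \<Rightarrow> l2 \<Rightarrow> complex) \<Rightarrow> bool"
  where "bounded_sesquilinear q \<longleftrightarrow> bounded_bilinear q \<and>
    (\<forall>c \<phi> \<psi>. q (c *\<^sub>C \<phi>) \<psi> = cnj c * q \<phi> \<psi> \<and> q \<phi> (c *\<^sub>C \<psi>) = c * q \<phi> \<psi>)"

text \<open>Unbounded operators are represented by their graphs. \<open>commutator_form A B q\<close>: the form
  $\langle A\varphi, B\psi\rangle - \langle\varphi, BA\psi\rangle$ on the domain of \<open>A\<close>
  extends to the bounded form \<open>q\<close>.\<close>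

definition commutator_form ::
    "(l2 \<times> l2) set \<Rightarrow> (l2 \<Rightarrow> l2) \<Rightarrow> (l2 \<Rightarrow> l2 \<Rightarrow> complex) \<Rightarrow> bool"
  where "commutator_form A B q \<longleftrightarrow> bounded_sesquilinear q \<and>
    (\<forall>(\<phi>, A\<phi>) \<in> A. \<forall>(\<psi>, A\<psi>) \<in> A. cinner A\<phi> (B \<psi>) - cinner \<phi> (B A\<psi>) = q \<phi> \<psi>)"

definition C1 :: "(l2 \<times> l2) set \<Rightarrow> (l2 \<Rightarrow> l2) set"
  where "C1 A = {B. bounded_clinear B \<and> (\<exists>q. commutator_form A B q)}"

text \<open>Determined uniquely when \<open>A\<close> is densely defined and \<open>B \<in> C1 A\<close>.\<close>

definition ad :: "(l2 \<times> l2) set \<Rightarrow> (l2 \<Rightarrow> l2) \<Rightarrow> l2 \<Rightarrow> l2"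
  where "ad A B = (THE C. bounded_clinear C \<and> commutator_form A B (\<lambda>\<phi> \<psi>. cinner \<phi> (C \<psi>)))"


section \<open>Position, Toeplitz and conjugate operators\<close>

definition dom_X :: "l2 set"
  where "dom_X = {\<psi>. summable (\<lambda>n. (real n)\<^sup>2 * (cmod (coord \<psi> n))\<^sup>2)}"

text \<open>Meaningful on \<open>dom_X\<close> only.\<close>

definition X_op :: "l2 \<Rightarrow> l2"
  where "X_op \<psi> = Abs_l2 (\<lambda>n. of_nat n * coord \<psi> n)"

definition X_graph :: "(l2 \<times> l2) set"
  where "X_graph = {(\<psi>, X_op \<psi>) |\<psi>. \<psi> \<in> dom_X}"

definition norm_X :: "l2 \<Rightarrow> real"
  where "norm_X \<psi> = sqrt ((norm \<psi>)\<^sup>2 + (norm (X_op \<psi>))\<^sup>2)"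

text \<open>Functions on the torus are $2\pi$-periodic functions on the real line.\<close>

definition fourier_coeff :: "(real \<Rightarrow> complex) \<Rightarrow> int \<Rightarrow> complex"
  where "fourier_coeff f n =
    (1 / (2 * pi)) *\<^sub>R (LINT \<theta>:{0..2 * pi}|lebesgue. exp (- \<i> * of_int n * of_real \<theta>) * f \<theta>)"

definition toeplitz :: "(real \<Rightarrow> complex) \<Rightarrow> l2 \<Rightarrow> l2"
  where "toeplitz f \<phi> = Abs_l2 (\<lambda>n. if n = 0 then 0
    else (\<Sum>\<^sub>\<infinity>k\<in>{1..}. fourier_coeff f (int n - int k) * coord \<phi> k))"

definition C_torus :: "nat \<Rightarrow> (real \<Rightarrow> real) \<Rightarrow> bool"
  where "C_torus k f \<longleftrightarrow> (\<forall>\<theta>. f (\<theta> + 2 * pi) = f \<theta>) \<and>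
    (\<forall>j<k. \<forall>\<theta>. (deriv ^^ j) f differentiable at \<theta>) \<and> continuous_on UNIV ((deriv ^^ k) f)"

text \<open>The closure of $\frac12(T_g X + X T_g)$ on \<open>dom_X\<close>, as the closure of its graph.\<close>

definition A_graph :: "(real \<Rightarrow> real) \<Rightarrow> (l2 \<times> l2) set"
  where "A_graph g = (let T = toeplitz (\<lambda>\<theta>. of_real (g \<theta>)) in
    closure {(\<psi>, (1/2) *\<^sub>R (T (X_op \<psi>) + X_op (T \<psi>))) |\<psi>. \<psi> \<in> dom_X})"

end

theory Submission
  imports Defs
begin

text \<open>
  The second moment of the position grows at most quadratically, and the commutator with \<open>A\<close> is
  its second derivative. Write \<open>T\<close> and \<open>T'\<close> for the Toeplitz operators with symbols \<open>f\<close> and \<open>f'\<close>,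
  \<open>A\<close> for \<open>(T'X + XT')/2\<close>, and \<open>\<psi>\<close> for the evolved state \<open>exp (iHt) \<phi>\<close>, whose norm is constant.
  On Fourier coefficients \<open>[X, T] = -iT'\<close>, hence \<open>i[X\<^sup>2, T] = 2A\<close>, and formally
  \<open>d/dt \<parallel>X\<psi>\<parallel>\<^sup>2 = 2\<langle>\<psi>, A\<psi>\<rangle> + i\<langle>\<psi>, [X\<^sup>2, V]\<psi>\<rangle>\<close> and \<open>d/dt \<langle>\<psi>, A\<psi>\<rangle> = i\<langle>\<psi>, [A, H]\<psi>\<rangle>\<close>.
  The term with \<open>[X\<^sup>2, V]\<close> is bounded because \<open>V\<close> is of class \<open>C\<^sup>1(X\<^sup>2)\<close>, and the second derivative is
  at most \<open>L\<parallel>\<phi>\<parallel>\<^sup>2\<close> with \<open>L\<close> the norm of \<open>[A, H]\<close>. Integrating twice gives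
  \<open>\<parallel>X\<psi>\<parallel>\<^sup>2 \<le> L\<parallel>\<phi>\<parallel>\<^sup>2 t\<^sup>2 + O(t)\<close> (\<open>evolution_quadratic_bound\<close>, \<open>quadratic_growth\<close>), and dividing by
  \<open>t\<^sup>2\<close> gives the theorem.

  To make this rigorous it suffices to work on the domain of \<open>X\<close>. There \<open>XH = HX + K\<close> with \<open>K\<close>
  bounded, so the exponential series converges in the graph norm of \<open>X\<close> and may be differentiated
  in it term by term (\<open>exp_flow_dom_X\<close>); the unbounded part \<open>iHX\<close> of the derivative of \<open>X\<psi>\<close> is
  orthogonal to \<open>X\<psi>\<close> and drops out. The quantity \<open>\<langle>\<psi>, A\<psi>\<rangle>\<close> appears as the real part of
  \<open>\<langle>X\<psi>, T'\<psi>\<rangle>\<close>, and \<open>[X\<^sup>2, V]\<close> as the imaginary part of \<open>\<langle>X\<psi>, [X, V]\<psi>\<rangle>\<close>, whose bound passes from the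
  domain of \<open>X\<^sup>2\<close> to that of \<open>X\<close> by truncation (\<open>C1_X_square_bound\<close>).

  The operator \<open>[A, H]\<close> exists only if \<open>T\<close> is of class \<open>C\<^sup>1(A)\<close> (\<open>toeplitz_A_commutator_form\<close>). On the
  domain of \<open>X\<close>, \<open>[A, T] = -iT'\<^sup>2 + (XD + DX)/2\<close> with \<open>D = [T', T]\<close>. On the whole line of integers
  the two convolutions commute, so the entries of \<open>D\<close> are sums over the indices missing from the half
  line, and the decay of the Fourier coefficients makes \<open>XD\<close> bounded
  (\<open>toeplitz_commutator_decay\<close>, \<open>X_op_smoothing\<close>).
\<close>

section \<open>The Hilbert space\<close>

instance l2 :: banach ..

lemma coord_add [simp]: "coord (\<phi> + \<psi>) n = coord \<phi> n + coord \<psi> n"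
  and coord_diff [simp]: "coord (\<phi> - \<psi>) n = coord \<phi> n - coord \<psi> n"
  and coord_minus [simp]: "coord (- \<psi>) n = - coord \<psi> n"
  and coord_zero [simp]: "coord 0 n = 0"
  and coord_scaleR [simp]: "coord (r *\<^sub>R \<psi>) n = r *\<^sub>R coord \<psi> n"
  and coord_scaleC [simp]: "coord (c *\<^sub>C \<psi>) n = c * coord \<psi> n"
  by (transfer, simp)+

lemma coord_Abs:
  assumes "\<psi> 0 = 0" "summable (\<lambda>n. (cmod (\<psi> n))\<^sup>2)"
  shows "coord (Abs_l2 \<psi>) = \<psi>"
  using assms by (simp add: Abs_l2_inverse)

lemma power2_norm_l2: "(norm \<psi>)\<^sup>2 = (\<Sum>n. (cmod (coord \<psi> n))\<^sup>2)"
  unfolding norm_l2_def by (simp add: suminf_nonneg[OF summable_coord])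

lemma bounded_linear_coord: "bounded_linear (\<lambda>\<psi>. coord \<psi> n)"
  by (rule bounded_linear_intro[of _ 1]) (simp_all add: cmod_coord_le_norm)

lemma scaleC_add_right: "c *\<^sub>C (\<phi> + \<psi>) = c *\<^sub>C \<phi> + c *\<^sub>C \<psi>"
  and scaleC_diff_right: "c *\<^sub>C (\<phi> - \<psi>) = c *\<^sub>C \<phi> - c *\<^sub>C \<psi>"
  and scaleC_minus_left: "(- c) *\<^sub>C \<psi> = - (c *\<^sub>C \<psi>)"
  and scaleC_scaleC [simp]: "c *\<^sub>C d *\<^sub>C \<psi> = (c * d) *\<^sub>C \<psi>"
  and scaleC_scaleR: "c *\<^sub>C (r *\<^sub>R \<psi>) = r *\<^sub>R (c *\<^sub>C \<psi>)"
  and scaleC_one [simp]: "1 *\<^sub>C \<psi> = \<psi>"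
  and scaleC_of_real: "of_real r *\<^sub>C \<psi> = r *\<^sub>R \<psi>"
  by (rule l2_eqI, simp add: algebra_simps scaleR_conv_of_real)+

lemma norm_scaleC [simp]: "norm (c *\<^sub>C \<psi>) = cmod c * norm \<psi>"
  unfolding norm_l2_def
  by (simp add: norm_mult power_mult_distrib suminf_mult[OF summable_coord] real_sqrt_mult)

lemma bounded_linear_scaleC: "bounded_linear (\<lambda>\<psi>. c *\<^sub>C \<psi>)"
  by (rule bounded_linear_intro[of _ "cmod c"])
    (simp_all add: scaleC_add_right scaleC_scaleR)

lemma cinner_add_left: "cinner (\<phi> + \<phi>') \<psi> = cinner \<phi> \<psi> + cinner \<phi>' \<psi>"
  unfolding cinner_def suminf_add[OF summable_cinner summable_cinner] by (simp add: ring_distribs)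

lemma cinner_add_right: "cinner \<phi> (\<psi> + \<psi>') = cinner \<phi> \<psi> + cinner \<phi> \<psi>'"
  unfolding cinner_def suminf_add[OF summable_cinner summable_cinner] by (simp add: ring_distribs)

lemma cinner_scaleC_right [simp]: "cinner \<phi> (c *\<^sub>C \<psi>) = c * cinner \<phi> \<psi>"
  unfolding cinner_def suminf_mult[OF summable_cinner, symmetric] by (simp add: mult_ac)

lemma cnj_cinner: "cnj (cinner \<phi> \<psi>) = cinner \<psi> \<phi>"
proof -
  have "(\<lambda>n. cnj (cnj (coord \<phi> n) * coord \<psi> n)) sums cnj (cinner \<phi> \<psi>)"
    unfolding cinner_def sums_cnj using summable_cinner by (rule summable_sums)
  then show ?thesis by (simp add: cinner_def mult.commute sums_iff)
qed

lemma cinner_scaleC_left [simp]: "cinner (c *\<^sub>C \<phi>) \<psi> = cnj c * cinner \<phi> \<psi>"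
  by (metis cnj_cinner cinner_scaleC_right complex_cnj_mult)

lemma cinner_scaleR_right [simp]: "cinner \<phi> (r *\<^sub>R \<psi>) = r *\<^sub>R cinner \<phi> \<psi>"
  and cinner_scaleR_left [simp]: "cinner (r *\<^sub>R \<phi>) \<psi> = r *\<^sub>R cinner \<phi> \<psi>"
  by (simp_all add: scaleC_of_real[symmetric] scaleR_conv_of_real)

text \<open>The real Cauchy--Schwarz inequality suffices: rotate one argument by the phase of the inner product.\<close>

lemma cmod_cinner_le: "cmod (cinner \<phi> \<psi>) \<le> norm \<phi> * norm \<psi>"
proof (cases "cinner \<phi> \<psi> = 0")
  case False
  define u where "u = cnj (sgn (cinner \<phi> \<psi>))"
  have "u * cinner \<phi> \<psi> = of_real (cmod (cinner \<phi> \<psi>))"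
    unfolding u_def sgn_eq
    by (simp add: complex_norm_square[symmetric] power2_eq_square mult.commute[of "cnj _"])
  then have "cmod (cinner \<phi> \<psi>) = inner \<phi> (u *\<^sub>C \<psi>)"
    by (simp add: inner_l2_def)
  also have "\<dots> \<le> norm \<phi> * norm (u *\<^sub>C \<psi>)" by (rule norm_cauchy_schwarz)
  also have "\<dots> = norm \<phi> * norm \<psi>" using False by (simp add: u_def norm_sgn)
  finally show ?thesis .
qed simp

lemma bounded_bilinear_cinner: "bounded_bilinear cinner"
  by unfold_locales
    (auto simp: cinner_add_left cinner_add_right intro!: exI[of _ 1] cmod_cinner_le)

lemmas cinner_diff_left = bounded_bilinear.diff_left[OF bounded_bilinear_cinner]
  and cinner_diff_right = bounded_bilinear.diff_right[OF bounded_bilinear_cinner]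
  and cinner_zero_right [simp] = bounded_bilinear.zero_right[OF bounded_bilinear_cinner]
  and cinner_zero_left [simp] = bounded_bilinear.zero_left[OF bounded_bilinear_cinner]
  and cinner_minus_right = bounded_bilinear.minus_right[OF bounded_bilinear_cinner]
  and tendsto_cinner = bounded_bilinear.tendsto[OF bounded_bilinear_cinner]

text \<open>The index 0 gives the zero vector, so that \<open>cinner_unit_vec\<close> holds for every index.\<close>

definition unit_vec :: "nat \<Rightarrow> l2"
  where "unit_vec n = Abs_l2 (\<lambda>k. if k = n \<and> n \<noteq> 0 then 1 else 0)"

lemma coord_unit_vec: "coord (unit_vec n) k = (if k = n \<and> n \<noteq> 0 then 1 else 0)"
proof -
  have "summable (\<lambda>k. (cmod (if k = n \<and> n \<noteq> 0 then 1 else 0 :: complex))\<^sup>2)"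
    by (rule summable_finite[of "{n}"]) auto
  then show ?thesis unfolding unit_vec_def by (subst coord_Abs) auto
qed

lemma cinner_unit_vec: "cinner (unit_vec n) \<psi> = coord \<psi> n"
proof -
  have "cinner (unit_vec n) \<psi> = (\<Sum>k\<in>{n}. cnj (coord (unit_vec n) k) * coord \<psi> k)"
    unfolding cinner_def by (rule suminf_finite) (auto simp: coord_unit_vec)
  then show ?thesis by (cases "n = 0") (auto simp: coord_unit_vec)
qed

definition truncate :: "nat \<Rightarrow> l2 \<Rightarrow> l2"
  where "truncate N \<psi> = (\<Sum>n<N. coord \<psi> n *\<^sub>C unit_vec n)"

lemma coord_sum: "coord (\<Sum>i\<in>I. \<phi> i) n = (\<Sum>i\<in>I. coord (\<phi> i) n)"
  by (rule bounded_linear.linear[OF bounded_linear_coord, THEN linear_sum])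

lemma coord_truncate: "coord (truncate N \<psi>) n = (if n < N then coord \<psi> n else 0)"
proof -
  have "coord (truncate N \<psi>) n = (\<Sum>k<N. if n = k then coord \<psi> k else 0)"
    unfolding truncate_def coord_sum
    by (intro sum.cong) (auto simp: coord_unit_vec)
  then show ?thesis by simp
qed

lemma truncate_tendsto: "(\<lambda>N. truncate N \<psi>) \<longlonglongrightarrow> \<psi>"
proof -
  have eq: "(norm (\<psi> - truncate N \<psi>))\<^sup>2 = (norm \<psi>)\<^sup>2 - (\<Sum>n<N. (cmod (coord \<psi> n))\<^sup>2)" for N
  proof -
    have "(norm (\<psi> - truncate N \<psi>))\<^sup>2
        = (\<Sum>n. (cmod (coord \<psi> n))\<^sup>2 - (if n \<in> {..<N} then (cmod (coord \<psi> n))\<^sup>2 else 0))"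
      unfolding power2_norm_l2 by (intro suminf_cong) (simp add: coord_truncate)
    also have "\<dots> = (norm \<psi>)\<^sup>2 - (\<Sum>n. if n \<in> {..<N} then (cmod (coord \<psi> n))\<^sup>2 else 0)"
      unfolding power2_norm_l2
      by (rule suminf_diff[symmetric, OF summable_coord], rule summable_finite[of "{..<N}"]) auto
    also have "(\<Sum>n. if n \<in> {..<N} then (cmod (coord \<psi> n))\<^sup>2 else 0) = (\<Sum>n<N. (cmod (coord \<psi> n))\<^sup>2)"
      by (subst suminf_finite[of "{..<N}"]) (auto intro!: sum.cong)
    finally show ?thesis .
  qed
  have "(\<lambda>N. (norm \<psi>)\<^sup>2 - (\<Sum>n<N. (cmod (coord \<psi> n))\<^sup>2)) \<longlonglongrightarrow> (norm \<psi>)\<^sup>2 - (norm \<psi>)\<^sup>2"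
    unfolding power2_norm_l2 by (intro tendsto_intros summable_LIMSEQ summable_coord)
  then have "(\<lambda>N. (norm (\<psi> - truncate N \<psi>))\<^sup>2) \<longlonglongrightarrow> 0"
    unfolding eq by simp
  then have "(\<lambda>N. sqrt ((norm (\<psi> - truncate N \<psi>))\<^sup>2)) \<longlonglongrightarrow> sqrt 0"
    by (rule tendsto_real_sqrt)
  then have "(\<lambda>N. norm (truncate N \<psi> - \<psi>)) \<longlonglongrightarrow> 0"
    by (simp add: norm_minus_commute)
  then show ?thesis
    using Lim_null tendsto_norm_zero_iff by fastforce
qed

section \<open>Bounded operators and forms\<close>

lemma bounded_clinearD:
  assumes "bounded_clinear B"
  shows "bounded_linear B" "B (\<phi> + \<psi>) = B \<phi> + B \<psi>" "B (\<phi> - \<psi>) = B \<phi> - B \<psi>"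
    "B (c *\<^sub>C \<psi>) = c *\<^sub>C B \<psi>" "B (r *\<^sub>R \<psi>) = r *\<^sub>R B \<psi>" "B 0 = 0" "B (- \<psi>) = - B \<psi>"
  using assms unfolding bounded_clinear_def
  by (auto simp: bounded_linear.linear linear_add linear_diff linear_scale linear_0 linear_neg)

lemma bounded_clinearI:
  assumes "\<And>\<phi> \<psi>. B (\<phi> + \<psi>) = B \<phi> + B \<psi>" "\<And>c \<psi>. B (c *\<^sub>C \<psi>) = c *\<^sub>C B \<psi>"
    and "\<And>\<psi>. norm (B \<psi>) \<le> K * norm \<psi>"
  shows "bounded_clinear B"
  unfolding bounded_clinear_def
proof (intro conjI allI assms(2) bounded_linear_intro[of _ K])
  show "B (r *\<^sub>R \<psi>) = r *\<^sub>R B \<psi>" for r \<psi>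
    using assms(2)[of "of_real r" \<psi>] by (simp add: scaleC_of_real)
qed (use assms in \<open>simp_all add: mult.commute\<close>)

lemma bounded_clinear_add:
  assumes "bounded_clinear B" "bounded_clinear C"
  shows "bounded_clinear (\<lambda>\<psi>. B \<psi> + C \<psi>)"
  using assms unfolding bounded_clinear_def
  by (auto intro: bounded_linear_add simp: scaleC_add_right)

lemma bounded_clinear_scaleC:
  assumes "bounded_clinear B"
  shows "bounded_clinear (\<lambda>\<psi>. c *\<^sub>C B \<psi>)"
  using assms bounded_linear_compose[OF bounded_linear_scaleC[of c], of B]
  unfolding bounded_clinear_def by (simp add: mult.commute)

text \<open>The coordinates of \<open>C \<psi>\<close> must be the values \<open>q (unit_vec n) \<psi>\<close>. They are square summable because
  testing \<open>q\<close> on their own partial sums \<open>\<eta>\<close> gives \<open>\<parallel>\<eta>\<parallel>\<^sup>2 = q \<eta> \<psi> \<le> K \<parallel>\<eta>\<parallel> \<parallel>\<psi>\<parallel>\<close>.\<close>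

lemma riesz_representation:
  assumes "bounded_sesquilinear q"
  obtains C where "bounded_clinear C" "\<And>\<phi> \<psi>. cinner \<phi> (C \<psi>) = q \<phi> \<psi>"
proof -
  interpret bounded_bilinear q using assms by (simp add: bounded_sesquilinear_def)
  have sc: "q (c *\<^sub>C \<phi>) \<psi> = cnj c * q \<phi> \<psi>" "q \<phi> (c *\<^sub>C \<psi>) = c * q \<phi> \<psi>" for c \<phi> \<psi>
    using assms by (simp_all add: bounded_sesquilinear_def)
  obtain K where K: "K > 0" "\<And>\<phi> \<psi>. cmod (q \<phi> \<psi>) \<le> norm \<phi> * norm \<psi> * K"
    using pos_bounded by blast
  have q0: "q (unit_vec 0) \<psi> = 0" for \<psi>
  proof -
    have "unit_vec 0 = 0" by (rule l2_eqI) (simp add: coord_unit_vec)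
    then show ?thesis by (simp add: zero_left)
  qed
  have part: "(\<Sum>n<N. (cmod (q (unit_vec n) \<psi>))\<^sup>2) \<le> (K * norm \<psi>)\<^sup>2" for N \<psi>
  proof -
    define S where "S = (\<Sum>n<N. (cmod (q (unit_vec n) \<psi>))\<^sup>2)"
    define \<eta> where "\<eta> = (\<Sum>n<N. q (unit_vec n) \<psi> *\<^sub>C unit_vec n)"
    have cx: "coord \<eta> n = (if n \<in> {..<N} then q (unit_vec n) \<psi> else 0)" for n
    proof -
      have "coord \<eta> n = (\<Sum>k<N. if n = k then q (unit_vec k) \<psi> else 0)"
        unfolding \<eta>_def coord_sum
        by (intro sum.cong) (use q0 in \<open>auto simp: coord_unit_vec\<close>)
      then show ?thesis by simp
    qed
    have nx: "(norm \<eta>)\<^sup>2 = S"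
      unfolding power2_norm_l2 S_def
      by (subst suminf_finite[of "{..<N}"]) (auto simp: cx)
    have "q \<eta> \<psi> = (\<Sum>n<N. cnj (q (unit_vec n) \<psi>) * q (unit_vec n) \<psi>)"
      unfolding \<eta>_def by (simp add: sum_left sc)
    also have "\<dots> = of_real S"
      unfolding S_def of_real_sum
      by (intro sum.cong refl) (metis complex_norm_square mult.commute)
    finally have q_eq: "q \<eta> \<psi> = of_real S" .
    have "S = cmod (q \<eta> \<psi>)" unfolding q_eq norm_of_real by (simp add: S_def sum_nonneg)
    also have "\<dots> \<le> norm \<eta> * (K * norm \<psi>)" using K(2)[of \<eta> \<psi>] by (simp add: mult_ac)
    finally have "norm \<eta> * norm \<eta> \<le> norm \<eta> * (K * norm \<psi>)"
      by (simp add: nx[symmetric] power2_eq_square)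
    then have "norm \<eta> \<le> K * norm \<psi>"
      using K(1) by (cases "norm \<eta> = 0") auto
    then show ?thesis
      unfolding S_def[symmetric] nx[symmetric] by (rule power_mono) simp
  qed
  define C where "C \<psi> = Abs_l2 (\<lambda>n. q (unit_vec n) \<psi>)" for \<psi>
  have sm: "summable (\<lambda>n. (cmod (q (unit_vec n) \<psi>))\<^sup>2)" for \<psi>
    using part by (intro summableI_nonneg_bounded) auto
  have cC: "coord (C \<psi>) n = q (unit_vec n) \<psi>" for \<psi> n
    unfolding C_def by (subst coord_Abs) (auto simp: q0 sm)
  have "norm (C \<psi>) \<le> K * norm \<psi>" for \<psi>
  proof (rule power2_le_imp_le)
    show "(norm (C \<psi>))\<^sup>2 \<le> (K * norm \<psi>)\<^sup>2"
      unfolding power2_norm_l2 cC by (rule suminf_le_const[OF sm part])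
  qed (use K in simp)
  then have "bounded_clinear C"
    by (intro bounded_clinearI[where K = K]) (auto intro!: l2_eqI simp: cC add_right sc)
  moreover have "cinner \<phi> (C \<psi>) = q \<phi> \<psi>" for \<phi> \<psi>
  proof (rule LIMSEQ_unique)
    show "(\<lambda>N. q (truncate N \<phi>) \<psi>) \<longlonglongrightarrow> q \<phi> \<psi>"
      by (intro tendsto truncate_tendsto tendsto_const)
    have "q (truncate N \<phi>) \<psi> = cinner (truncate N \<phi>) (C \<psi>)" for N
      unfolding truncate_def sum_left bounded_bilinear.sum_left[OF bounded_bilinear_cinner]
      by (simp add: sc cinner_unit_vec cC)
    then show "(\<lambda>N. q (truncate N \<phi>) \<psi>) \<longlonglongrightarrow> cinner \<phi> (C \<psi>)"
      by (simp add: tendsto_cinner truncate_tendsto)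
  qed
  ultimately show ?thesis by (rule that)
qed

section \<open>The position operator\<close>

text \<open>Membership in the domain and the value of \<open>X_op\<close> come together from a vector with the right
  coordinates; in particular \<open>X_op\<close> is closed, since coordinates are continuous.\<close>

lemma dom_XI:
  assumes "\<And>n. coord \<eta> n = of_nat n * coord \<psi> n"
  shows "\<psi> \<in> dom_X" "X_op \<psi> = \<eta>"
proof -
  have "(\<lambda>n. of_nat n * coord \<psi> n) = coord \<eta>" using assms by auto
  then show "X_op \<psi> = \<eta>" by (simp add: X_op_def coord_inverse)
  show "\<psi> \<in> dom_X"
    using summable_coord[of \<eta>] by (simp add: dom_X_def assms norm_mult power_mult_distrib)
qed

lemma coord_X_op:
  assumes "\<psi> \<in> dom_X"
  shows "coord (X_op \<psi>) n = of_nat n * coord \<psi> n"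
  using assms unfolding X_op_def dom_X_def
  by (subst coord_Abs) (auto simp: norm_mult power_mult_distrib)

lemma X_op_add:
  assumes "\<phi> \<in> dom_X" "\<psi> \<in> dom_X"
  shows "\<phi> + \<psi> \<in> dom_X" "X_op (\<phi> + \<psi>) = X_op \<phi> + X_op \<psi>"
proof -
  have c: "coord (X_op \<phi> + X_op \<psi>) n = of_nat n * coord (\<phi> + \<psi>) n" for n
    using assms by (simp add: coord_X_op algebra_simps)
  show "\<phi> + \<psi> \<in> dom_X" "X_op (\<phi> + \<psi>) = X_op \<phi> + X_op \<psi>"
    by (rule dom_XI[OF c])+
qed

lemma X_op_scaleC:
  assumes "\<psi> \<in> dom_X"
  shows "c *\<^sub>C \<psi> \<in> dom_X" "X_op (c *\<^sub>C \<psi>) = c *\<^sub>C X_op \<psi>"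
proof -
  have c: "coord (c *\<^sub>C X_op \<psi>) n = of_nat n * coord (c *\<^sub>C \<psi>) n" for n
    using assms by (simp add: coord_X_op algebra_simps)
  show "c *\<^sub>C \<psi> \<in> dom_X" "X_op (c *\<^sub>C \<psi>) = c *\<^sub>C X_op \<psi>"
    by (rule dom_XI[OF c])+
qed

lemma X_op_scaleR:
  assumes "\<psi> \<in> dom_X"
  shows "r *\<^sub>R \<psi> \<in> dom_X" "X_op (r *\<^sub>R \<psi>) = r *\<^sub>R X_op \<psi>"
  using X_op_scaleC[OF assms, of "of_real r"] by (simp_all add: scaleC_of_real)

text \<open>Closedness of \<open>X_op\<close>, in the form used for the exponential series.\<close>

lemma X_op_suminf:
  assumes v: "\<And>k. v k \<in> dom_X" and s: "summable v" "summable (\<lambda>k. X_op (v k))"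
  shows "(\<Sum>k. v k) \<in> dom_X" "X_op (\<Sum>k. v k) = (\<Sum>k. X_op (v k))"
proof -
  have "coord (\<Sum>k. X_op (v k)) n = of_nat n * coord (\<Sum>k. v k) n" for n
    unfolding bounded_linear.suminf[OF bounded_linear_coord s(1)]
      bounded_linear.suminf[OF bounded_linear_coord s(2)] coord_X_op[OF v]
    by (rule suminf_mult, rule bounded_linear.summable[OF bounded_linear_coord s(1)])
  from dom_XI[OF this] show "(\<Sum>k. v k) \<in> dom_X" "X_op (\<Sum>k. v k) = (\<Sum>k. X_op (v k))" .
qed

lemma X_op_symmetric:
  assumes "\<phi> \<in> dom_X" "\<psi> \<in> dom_X"
  shows "cinner (X_op \<phi>) \<psi> = cinner \<phi> (X_op \<psi>)"
  using assms by (simp add: cinner_def coord_X_op mult_ac)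

lemma truncate_dom_X: "truncate N \<psi> \<in> dom_X"
  unfolding dom_X_def mem_Collect_eq
  by (rule summable_finite[of "{..<N}"]) (auto simp: coord_truncate)

lemma X_op_truncate:
  assumes "\<psi> \<in> dom_X"
  shows "X_op (truncate N \<psi>) = truncate N (X_op \<psi>)"
  using assms by (auto intro!: dom_XI simp: coord_truncate coord_X_op)

lemma symmetric_op_Im:
  assumes "symmetric_op B"
  shows "Im (cinner \<psi> (B \<psi>)) = 0"
proof -
  have "cnj (cinner \<psi> (B \<psi>)) = cinner \<psi> (B \<psi>)"
    using assms by (simp add: cnj_cinner symmetric_op_def)
  then show ?thesis by (simp add: complex_eq_iff)
qed

text \<open>Testing the commutator form against the unit vectors, which lie in the domain, computes
  \<open>X V \<psi>\<close> coordinate by coordinate; so \<open>V\<close> preserves the domain of \<open>X\<close> without any appeal to adjoints.\<close>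

lemma C1_X_commutator:
  assumes "V \<in> C1 X_graph"
  obtains Q where "bounded_clinear Q" "\<And>\<psi>. \<psi> \<in> dom_X \<Longrightarrow> V \<psi> \<in> dom_X"
    "\<And>\<psi>. \<psi> \<in> dom_X \<Longrightarrow> X_op (V \<psi>) = V (X_op \<psi>) + Q \<psi>"
proof -
  obtain q where q: "bounded_sesquilinear q"
    and form: "\<And>\<phi> \<psi>. \<phi> \<in> dom_X \<Longrightarrow> \<psi> \<in> dom_X \<Longrightarrow>
      cinner (X_op \<phi>) (V \<psi>) - cinner \<phi> (V (X_op \<psi>)) = q \<phi> \<psi>"
    using assms unfolding C1_def commutator_form_def X_graph_def by auto
  obtain Q where Q: "bounded_clinear Q" "\<And>\<phi> \<psi>. cinner \<phi> (Q \<psi>) = q \<phi> \<psi>"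
    using riesz_representation[OF q] by blast
  have "coord (V (X_op \<psi>) + Q \<psi>) n = of_nat n * coord (V \<psi>) n" if "\<psi> \<in> dom_X" for \<psi> n
  proof -
    have c: "coord (of_nat n *\<^sub>C unit_vec n) k = of_nat k * coord (unit_vec n) k" for k
      by (simp add: coord_unit_vec)
    have "cinner (of_nat n *\<^sub>C unit_vec n) (V \<psi>) - cinner (unit_vec n) (V (X_op \<psi>))
        = cinner (unit_vec n) (Q \<psi>)"
      using form[of "unit_vec n" \<psi>, OF dom_XI(1)[OF c] that] dom_XI(2)[OF c] Q(2) by simp
    then show ?thesis by (simp add: cinner_unit_vec algebra_simps)
  qed
  then show ?thesis using that[OF Q(1)] by (metis dom_XI)
qed

text \<open>On the domain of \<open>X\<^sup>2\<close> the diagonal of the form of \<open>[X\<^sup>2, V]\<close> is \<open>2i Im \<langle>X\<psi>, [X, V]\<psi>\<rangle>\<close>: move one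
  factor \<open>X\<close> to the other side and cancel the real number \<open>\<langle>X\<psi>, V X\<psi>\<rangle>\<close>. Both sides of the estimate
  are continuous in the graph norm of \<open>X\<close>, in which truncations of \<open>\<psi>\<close> converge to \<open>\<psi>\<close>.\<close>

lemma C1_X_square_bound:
  assumes V: "bounded_clinear V" "symmetric_op V" "V \<in> C1 (X_graph O X_graph)"
    and Q: "bounded_clinear Q" "\<And>\<psi>. \<psi> \<in> dom_X \<Longrightarrow> V \<psi> \<in> dom_X"
      "\<And>\<psi>. \<psi> \<in> dom_X \<Longrightarrow> X_op (V \<psi>) = V (X_op \<psi>) + Q \<psi>"
  obtains K where "\<And>\<psi>. \<psi> \<in> dom_X \<Longrightarrow> \<bar>2 * Im (cinner (X_op \<psi>) (Q \<psi>))\<bar> \<le> K * (norm \<psi>)\<^sup>2"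
proof -
  obtain q where q: "bounded_sesquilinear q"
    and form: "\<And>\<psi>. \<psi> \<in> dom_X \<Longrightarrow> X_op \<psi> \<in> dom_X \<Longrightarrow>
      cinner (X_op (X_op \<psi>)) (V \<psi>) - cinner \<psi> (V (X_op (X_op \<psi>))) = q \<psi> \<psi>"
    using V(3) unfolding C1_def commutator_form_def X_graph_def by fastforce
  interpret q: bounded_bilinear q using q by (simp add: bounded_sesquilinear_def)
  obtain K where K: "\<And>\<phi> \<psi>. cmod (q \<phi> \<psi>) \<le> norm \<phi> * norm \<psi> * K" using q.pos_bounded by blast
  have core: "\<bar>2 * Im (cinner (X_op \<psi>) (Q \<psi>))\<bar> \<le> K * (norm \<psi>)\<^sup>2"
    if d: "\<psi> \<in> dom_X" "X_op \<psi> \<in> dom_X" for \<psi>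
  proof -
    have "q \<psi> \<psi> = cinner (X_op (X_op \<psi>)) (V \<psi>) - cinner (V \<psi>) (X_op (X_op \<psi>))"
      using V(2) form[OF d] by (simp add: symmetric_op_def)
    also have "\<dots> = cinner (X_op \<psi>) (X_op (V \<psi>)) - cinner (X_op (V \<psi>)) (X_op \<psi>)"
      using d Q(2)[OF d(1)] by (simp add: X_op_symmetric)
    also have "\<dots> = 2 * \<i> * Im (cinner (X_op \<psi>) (X_op (V \<psi>)))"
      by (subst cnj_cinner[symmetric]) (simp add: complex_eq_iff)
    also have "Im (cinner (X_op \<psi>) (X_op (V \<psi>))) = Im (cinner (X_op \<psi>) (Q \<psi>))"
      by (simp add: Q(3)[OF d(1)] cinner_add_right symmetric_op_Im[OF V(2)])
    finally have "cmod (q \<psi> \<psi>) = \<bar>2 * Im (cinner (X_op \<psi>) (Q \<psi>))\<bar>"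
      by (simp add: norm_mult)
    then show ?thesis using K[of \<psi> \<psi>] by (simp add: power2_eq_square mult_ac)
  qed
  have "\<bar>2 * Im (cinner (X_op \<psi>) (Q \<psi>))\<bar> \<le> K * (norm \<psi>)\<^sup>2" if d: "\<psi> \<in> dom_X" for \<psi>
  proof (rule LIMSEQ_le)
    show "(\<lambda>N. K * (norm (truncate N \<psi>))\<^sup>2) \<longlonglongrightarrow> K * (norm \<psi>)\<^sup>2"
      by (intro tendsto_intros truncate_tendsto)
    show "(\<lambda>N. \<bar>2 * Im (cinner (X_op (truncate N \<psi>)) (Q (truncate N \<psi>)))\<bar>)
        \<longlonglongrightarrow> \<bar>2 * Im (cinner (X_op \<psi>) (Q \<psi>))\<bar>"
      unfolding X_op_truncate[OF d]
      by (intro tendsto_intros tendsto_cinner truncate_tendsto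
          bounded_linear.tendsto[OF bounded_clinearD(1)[OF Q(1)]])
    show "\<exists>N. \<forall>n\<ge>N. \<bar>2 * Im (cinner (X_op (truncate n \<psi>)) (Q (truncate n \<psi>)))\<bar>
        \<le> K * (norm (truncate n \<psi>))\<^sup>2"
      by (intro exI allI impI core truncate_dom_X) (simp add: X_op_truncate[OF d] truncate_dom_X)
  qed
  then show ?thesis by (rule that)
qed

section \<open>Fourier coefficients\<close>

lemma fourier_coeff_eq_integral:
  assumes "continuous_on {0..2 * pi} g"
  shows "fourier_coeff g n =
    (1 / (2 * pi)) *\<^sub>R integral {0..2 * pi} (\<lambda>\<theta>. exp (- \<i> * of_int n * of_real \<theta>) * g \<theta>)"
  unfolding fourier_coeff_def
  by (subst set_lebesgue_integral_eq_integral(2))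
    (auto intro!: absolutely_integrable_continuous_real continuous_intros assms)

lemma fourier_coeff_bounded:
  assumes "continuous_on {0..2 * pi} g"
  obtains K where "\<And>n. cmod (fourier_coeff g n) \<le> K"
proof -
  obtain B where B: "\<And>\<theta>. \<theta> \<in> {0..2 * pi} \<Longrightarrow> cmod (g \<theta>) \<le> B"
    using compact_imp_bounded[OF compact_continuous_image[OF assms]] unfolding bounded_iff by blast
  have "cmod (fourier_coeff g n) \<le> (1 / (2 * pi)) * (B * (2 * pi - 0))" for n
  proof -
    have "cmod (integral {0..2 * pi} (\<lambda>\<theta>. exp (- \<i> * of_int n * of_real \<theta>) * g \<theta>)) \<le> B * (2 * pi - 0)"
      by (rule integral_bound) (auto intro!: continuous_intros assms simp: norm_mult B)
    then show ?thesis
      unfolding fourier_coeff_eq_integral[OF assms] norm_scaleR by (intro mult_mono) auto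
  qed
  then show ?thesis by (rule that)
qed

text \<open>Integration by parts; the boundary terms cancel by periodicity.\<close>

lemma fourier_coeff_derivative:
  fixes g g' :: "real \<Rightarrow> real"
  assumes g: "\<And>\<theta>. (g has_real_derivative g' \<theta>) (at \<theta>)" and g': "continuous_on UNIV g'"
    and per: "\<And>\<theta>. g (\<theta> + 2 * pi) = g \<theta>"
  shows "fourier_coeff (\<lambda>\<theta>. of_real (g' \<theta>)) n = \<i> * of_int n * fourier_coeff (\<lambda>\<theta>. of_real (g \<theta>)) n"
proof -
  define E where "E \<theta> = exp (- \<i> * of_int n * of_real \<theta>)" for \<theta> :: real
  have cg: "continuous_on {0..2 * pi} (\<lambda>\<theta>. complex_of_real (g \<theta>))"
    using g by (intro continuous_intros DERIV_continuous_on) (auto intro: DERIV_subset)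
  have cg': "continuous_on {0..2 * pi} (\<lambda>\<theta>. complex_of_real (g' \<theta>))"
    by (intro continuous_intros continuous_on_subset[OF g']) auto
  have cE: "continuous_on {0..2 * pi} E" unfolding E_def by (intro continuous_intros)
  have E': "(E has_vector_derivative (- \<i> * of_int n) * E \<theta>) (at \<theta>)" for \<theta>
  proof -
    have "((\<lambda>z. exp (- \<i> * of_int n * z)) has_field_derivative
        exp (- \<i> * of_int n * of_real \<theta>) * (- \<i> * of_int n)) (at (of_real \<theta>))"
      by (rule DERIV_chain'[where g = exp and f = "\<lambda>z. - \<i> * of_int n * z"])
        (rule DERIV_cmult_Id, rule DERIV_exp)
    from has_vector_derivative_real_field[OF this] show ?thesis
      unfolding E_def by (simp add: mult.commute)
  qed
  have "((\<lambda>\<theta>. E \<theta> * of_real (g \<theta>)) has_vector_derivative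
      E \<theta> * of_real (g' \<theta>) + (- \<i> * of_int n) * E \<theta> * of_real (g \<theta>)) (at \<theta>)" for \<theta>
    using g[of \<theta>]
    by (intro has_vector_derivative_mult E' has_vector_derivative_of_real)
      (simp add: has_real_derivative_iff_has_vector_derivative)
  then have "((\<lambda>\<theta>. E \<theta> * of_real (g' \<theta>) + (- \<i> * of_int n) * E \<theta> * of_real (g \<theta>)) has_integral
      E (2 * pi) * of_real (g (2 * pi)) - E 0 * of_real (g 0)) {0..2 * pi}"
    by (intro fundamental_theorem_of_calculus) (auto intro: has_vector_derivative_at_within)
  moreover have "E (2 * pi) = 1"
    using exp_integer_2pi[of "of_int (- n)"] by (simp add: E_def mult_ac)
  moreover have "g (2 * pi) = g 0" "E 0 = 1" using per[of 0] by (simp_all add: E_def)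
  ultimately have zero: "((\<lambda>\<theta>. E \<theta> * of_real (g' \<theta>) + (- \<i> * of_int n) * (E \<theta> * of_real (g \<theta>))) has_integral 0)
      {0..2 * pi}" by (simp add: mult.assoc)
  have "((\<lambda>\<theta>. E \<theta> * of_real (g' \<theta>) + (- \<i> * of_int n) * (E \<theta> * of_real (g \<theta>))) has_integral
      integral {0..2 * pi} (\<lambda>\<theta>. E \<theta> * of_real (g' \<theta>)) +
      (- \<i> * of_int n) * integral {0..2 * pi} (\<lambda>\<theta>. E \<theta> * of_real (g \<theta>))) {0..2 * pi}"
    by (intro has_integral_add has_integral_mult_right integrable_integral
        integrable_continuous_real continuous_intros cE cg cg')
  from has_integral_unique[OF zero this]
  have "integral {0..2 * pi} (\<lambda>\<theta>. E \<theta> * of_real (g' \<theta>)) =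
      \<i> * of_int n * integral {0..2 * pi} (\<lambda>\<theta>. E \<theta> * of_real (g \<theta>))"
    by (simp add: add_eq_0_iff2)
  then show ?thesis
    unfolding fourier_coeff_eq_integral[OF cg] fourier_coeff_eq_integral[OF cg'] E_def[symmetric]
    by simp
qed

lemma fourier_coeff_minus:
  fixes g :: "real \<Rightarrow> real"
  assumes "continuous_on {0..2 * pi} g"
  shows "fourier_coeff (\<lambda>\<theta>. of_real (g \<theta>)) (- n) = cnj (fourier_coeff (\<lambda>\<theta>. of_real (g \<theta>)) n)"
proof -
  have cont: "continuous_on {0..2 * pi} (\<lambda>\<theta>. complex_of_real (g \<theta>))"
    by (intro continuous_intros assms)
  have "cnj (integral {0..2 * pi} (\<lambda>\<theta>. exp (- \<i> * of_int n * of_real \<theta>) * of_real (g \<theta>))) =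
    integral {0..2 * pi} (cnj \<circ> (\<lambda>\<theta>. exp (- \<i> * of_int n * of_real \<theta>) * of_real (g \<theta>)))"
    by (rule integral_linear[symmetric])
      (auto intro!: integrable_continuous_real continuous_intros assms bounded_linear_cnj)
  then show ?thesis
    unfolding fourier_coeff_eq_integral[OF cont] by (simp add: o_def exp_cnj)
qed

lemma C_torus_continuous:
  assumes "C_torus k f"
  shows "continuous_on UNIV f"
proof (cases k)
  case 0
  then show ?thesis using assms by (simp add: C_torus_def)
next
  case (Suc j)
  then have "f differentiable at \<theta>" for \<theta>
    using assms unfolding C_torus_def by (metis funpow_0 zero_less_Suc)
  then show ?thesis
    by (simp add: continuous_at_imp_continuous_on differentiable_imp_continuous_within)
qed

lemma C_torus_Suc:
  assumes "C_torus (Suc k) f"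
  shows "C_torus k (deriv f)" "(f has_real_derivative deriv f \<theta>) (at \<theta>)" "f (\<theta> + 2 * pi) = f \<theta>"
proof -
  have d: "(f has_real_derivative deriv f \<theta>) (at \<theta>)" for \<theta>
    using assms unfolding C_torus_def
    by (metis DERIV_deriv_iff_real_differentiable funpow_0 zero_less_Suc)
  then show "(f has_real_derivative deriv f \<theta>) (at \<theta>)" .
  have per: "f (\<theta> + 2 * pi) = f \<theta>" for \<theta> using assms by (simp add: C_torus_def)
  then show "f (\<theta> + 2 * pi) = f \<theta>" .
  have "deriv f (\<theta> + 2 * pi) = deriv f \<theta>" for \<theta>
    using d[of "\<theta> + 2 * pi"] d[of \<theta>] unfolding DERIV_shift per by (rule DERIV_unique)
  moreover have "(deriv ^^ j) (deriv f) = (deriv ^^ Suc j) f" for j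
    by (simp add: funpow_swap1)
  ultimately show "C_torus k (deriv f)"
    using assms unfolding C_torus_def by (auto simp del: funpow.simps)
qed

lemma fourier_coeff_deriv:
  assumes "C_torus (Suc k) f"
  shows "fourier_coeff (\<lambda>\<theta>. of_real (deriv f \<theta>)) n = \<i> * of_int n * fourier_coeff (\<lambda>\<theta>. of_real (f \<theta>)) n"
  using C_torus_Suc[OF assms] by (intro fourier_coeff_derivative C_torus_continuous[of k]) auto

lemma fourier_coeff_deriv_funpow:
  assumes "C_torus k f"
  shows "cmod (fourier_coeff (\<lambda>\<theta>. of_real ((deriv ^^ k) f \<theta>)) n) =
    \<bar>of_int n\<bar> ^ k * cmod (fourier_coeff (\<lambda>\<theta>. of_real (f \<theta>)) n)"
  using assms
proof (induction k arbitrary: f)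
  case (Suc k)
  show ?case
    using Suc.IH[OF C_torus_Suc(1)[OF Suc.prems]]
    by (simp add: funpow_swap1 fourier_coeff_deriv[OF Suc.prems] norm_mult mult_ac)
qed simp

text \<open>The highest derivative is continuous, so its coefficients are bounded, and they are those of \<open>f\<close>
  multiplied by \<open>n\<^sup>k\<close> in modulus. The weight \<open>1 + \<bar>n\<bar>\<close> replaces \<open>\<bar>n\<bar>\<close> to include the index 0.\<close>

lemma fourier_coeff_decay:
  assumes "C_torus k f"
  obtains K where "\<And>n. cmod (fourier_coeff (\<lambda>\<theta>. of_real (f \<theta>)) n) \<le> K / (1 + \<bar>of_int n\<bar>) ^ k" "K \<ge> 0"
proof -
  let ?a = "\<lambda>n. cmod (fourier_coeff (\<lambda>\<theta>. of_real (f \<theta>)) n)"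
  have c: "continuous_on {0..2 * pi} (\<lambda>\<theta>. complex_of_real (f \<theta>))"
    by (intro continuous_intros continuous_on_subset[OF C_torus_continuous[OF assms]]) auto
  have c': "continuous_on {0..2 * pi} (\<lambda>\<theta>. complex_of_real ((deriv ^^ k) f \<theta>))"
    using assms unfolding C_torus_def
    by (intro continuous_on_of_real) (blast intro: continuous_on_subset)
  obtain A where A: "\<And>n. ?a n \<le> A" using fourier_coeff_bounded[OF c] by blast
  obtain B where B: "\<And>n. \<bar>of_int n\<bar> ^ k * ?a n \<le> B"
    using fourier_coeff_bounded[OF c'] unfolding fourier_coeff_deriv_funpow[OF assms] by blast
  have AB: "A \<ge> 0" "B \<ge> 0"
    using order_trans[OF norm_ge_zero A[of 0]] order_trans[OF _ B[of 0], of 0] by auto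
  \<comment> \<open>The constant \<open>A\<close> serves the index 0, and \<open>1 + \<bar>n\<bar> \<le> 2\<bar>n\<bar>\<close> accounts for \<open>2\<^sup>k\<close> at the others.\<close>
  have "?a n \<le> (A + 2 ^ k * B) / (1 + \<bar>of_int n\<bar>) ^ k" for n :: int
  proof -
    have "(1 + \<bar>of_int n\<bar>) ^ k * ?a n \<le> A + 2 ^ k * B"
    proof (cases "n = 0")
      case True
      have "?a n \<le> A" "0 \<le> 2 ^ k * B" using A AB by auto
      with True show ?thesis by simp
    next
      case False
      then have "(1 :: real) \<le> \<bar>of_int n\<bar>" by linarith
      then have "(1 + \<bar>of_int n\<bar>) ^ k * ?a n \<le> (2 * \<bar>of_int n\<bar>) ^ k * ?a n"
        by (intro mult_right_mono power_mono) auto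
      also have "\<dots> = 2 ^ k * (\<bar>of_int n\<bar> ^ k * ?a n)" by (simp add: power_mult_distrib)
      also have "\<dots> \<le> 2 ^ k * B" by (intro mult_left_mono B) simp
      finally show ?thesis using AB by linarith
    qed
    then show ?thesis by (simp add: pos_le_divide_eq add_pos_nonneg mult.commute)
  qed
  then show ?thesis by (rule that) (use AB in simp)
qed

section \<open>Toeplitz operators with summable symbols\<close>

text \<open>Cauchy--Schwarz in each row, applied to the factorization of \<open>p\<close> through \<open>\<alpha>\<close> and \<open>\<beta>\<close>, and then
  summation over the columns. The two weights are kept separate because the lemma is used in two
  ways: a summable kernel acting on \<open>l\<^sup>2\<close>, and a square summable kernel acting on \<open>l\<^sup>1\<close>.\<close>

lemma schur_test:
  fixes p :: "nat \<Rightarrow> nat \<Rightarrow> complex" and \<alpha> \<beta> :: "nat \<Rightarrow> nat \<Rightarrow> real"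
  assumes p: "\<And>n k. (cmod (p n k))\<^sup>2 \<le> \<alpha> n k * \<beta> n k"
    and nonneg: "\<And>n k. 0 \<le> \<alpha> n k" "\<And>n k. 0 \<le> \<beta> n k"
    and rows: "\<And>n m. (\<Sum>k<m. \<alpha> n k) \<le> R"
    and cols: "\<And>m k. (\<Sum>n<m. \<beta> n k) \<le> \<gamma> k" and \<gamma>: "\<And>m. (\<Sum>k<m. \<gamma> k) \<le> G"
  shows "summable (\<lambda>k. cmod (p n k))" "(\<Sum>n<N. (cmod (\<Sum>k. p n k))\<^sup>2) \<le> R * G"
proof -
  have R: "0 \<le> R" using rows[of _ 0] by simp
  have cs: "(\<Sum>k<m. cmod (p n k))\<^sup>2 \<le> R * (\<Sum>k<m. \<beta> n k)" for n m
  proof -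
    have "(\<Sum>k<m. cmod (p n k))\<^sup>2 \<le> (\<Sum>k<m. sqrt (\<alpha> n k) * sqrt (\<beta> n k))\<^sup>2"
      using p by (intro power_mono sum_mono sum_nonneg)
        (auto simp: real_sqrt_mult[symmetric] intro: real_le_rsqrt)
    also have "\<dots> \<le> (\<Sum>k<m. (sqrt (\<alpha> n k))\<^sup>2) * (\<Sum>k<m. (sqrt (\<beta> n k))\<^sup>2)"
      by (rule Cauchy_Schwarz_ineq_sum)
    also have "\<dots> = (\<Sum>k<m. \<alpha> n k) * (\<Sum>k<m. \<beta> n k)" by (simp add: nonneg)
    also have "\<dots> \<le> R * (\<Sum>k<m. \<beta> n k)"
      by (intro mult_right_mono rows sum_nonneg nonneg)
    finally show ?thesis .
  qed
  have partial: "(\<Sum>n<N. (\<Sum>k<m. cmod (p n k))\<^sup>2) \<le> R * G" for N m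
  proof -
    have "(\<Sum>n<N. (\<Sum>k<m. cmod (p n k))\<^sup>2) \<le> (\<Sum>n<N. R * (\<Sum>k<m. \<beta> n k))"
      by (intro sum_mono cs)
    also have "\<dots> = R * (\<Sum>k<m. \<Sum>n<N. \<beta> n k)"
      by (subst sum.swap) (simp add: sum_distrib_left)
    also have "\<dots> \<le> R * (\<Sum>k<m. \<gamma> k)" by (intro mult_left_mono sum_mono cols R)
    also have "\<dots> \<le> R * G" by (intro mult_left_mono \<gamma> R)
    finally show ?thesis .
  qed
  have sm: "summable (\<lambda>k. cmod (p n k))" for n
  proof (rule summableI_nonneg_bounded)
    fix m
    have "(\<Sum>k<m. cmod (p n k))\<^sup>2 \<le> (\<Sum>i<Suc n. (\<Sum>k<m. cmod (p i k))\<^sup>2)"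
      by (rule member_le_sum) auto
    also have "\<dots> \<le> R * G" by (rule partial)
    finally show "(\<Sum>k<m. cmod (p n k)) \<le> sqrt (R * G)" by (rule real_le_rsqrt)
  qed simp
  then show "summable (\<lambda>k. cmod (p n k))" .
  show "(\<Sum>n<N. (cmod (\<Sum>k. p n k))\<^sup>2) \<le> R * G"
  proof (rule LIMSEQ_le_const2)
    show "(\<lambda>m. \<Sum>n<N. (cmod (\<Sum>k<m. p n k))\<^sup>2) \<longlonglongrightarrow> (\<Sum>n<N. (cmod (\<Sum>k. p n k))\<^sup>2)"
      by (intro tendsto_intros summable_LIMSEQ summable_norm_cancel[OF sm])
    have "(\<Sum>n<N. (cmod (\<Sum>k<m. p n k))\<^sup>2) \<le> R * G" for m
      by (rule order_trans[OF _ partial[of m N]]) (intro sum_mono power_mono norm_sum norm_ge_zero)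
    then show "\<exists>M. \<forall>m\<ge>M. (\<Sum>n<N. (cmod (\<Sum>k<m. p n k))\<^sup>2) \<le> R * G" by blast
  qed
qed

lemma sum_le_infsum_reindex:
  fixes u :: "int \<Rightarrow> real"
  assumes "u summable_on UNIV" "\<And>j. 0 \<le> u j" "finite I" "inj_on h I"
  shows "(\<Sum>i\<in>I. u (h i)) \<le> infsum u UNIV"
  using finite_sum_le_infsum[of u UNIV "h ` I"] assms by (simp add: sum.reindex)

lemma convolution_l1_l2:
  assumes a: "(\<lambda>j. cmod (a j)) summable_on UNIV"
  defines "R \<equiv> infsum (\<lambda>j. cmod (a j)) UNIV"
  shows "summable (\<lambda>k. cmod (a (int n - int k) * coord \<psi> k))"
    "(\<Sum>n<N. (cmod (\<Sum>k. a (int n - int k) * coord \<psi> k))\<^sup>2) \<le> (R * norm \<psi>)\<^sup>2"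
proof -
  have R: "(\<Sum>k<m. cmod (a (int n - int k))) \<le> R" for n m
    unfolding R_def by (rule sum_le_infsum_reindex[OF a]) (auto simp: inj_on_def)
  have R': "(\<Sum>n<m. cmod (a (int n - int k))) \<le> R" for k m
    unfolding R_def by (rule sum_le_infsum_reindex[OF a]) (auto simp: inj_on_def)
  have R0: "0 \<le> R" using R[of _ 0] by simp
  have sq: "(cmod (a (int n - int k) * coord \<psi> k))\<^sup>2
      \<le> cmod (a (int n - int k)) * (cmod (a (int n - int k)) * (cmod (coord \<psi> k))\<^sup>2)" for n k
    by (simp add: norm_mult power2_eq_square mult_ac)
  have cols: "(\<Sum>n<m. cmod (a (int n - int k)) * (cmod (coord \<psi> k))\<^sup>2) \<le> R * (cmod (coord \<psi> k))\<^sup>2" for m k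
    unfolding sum_distrib_right[symmetric] by (intro mult_right_mono R') simp
  have tot: "(\<Sum>k<m. R * (cmod (coord \<psi> k))\<^sup>2) \<le> R * (norm \<psi>)\<^sup>2" for m
    unfolding sum_distrib_left[symmetric] power2_norm_l2
    by (intro mult_left_mono sum_le_suminf summable_coord R0) auto
  note * = schur_test[OF sq _ _ R cols tot]
  show "summable (\<lambda>k. cmod (a (int n - int k) * coord \<psi> k))" by (rule *(1)) auto
  have "(\<Sum>n<N. (cmod (\<Sum>k. a (int n - int k) * coord \<psi> k))\<^sup>2) \<le> R * (R * (norm \<psi>)\<^sup>2)"
    by (rule *(2)) auto
  then show "(\<Sum>n<N. (cmod (\<Sum>k. a (int n - int k) * coord \<psi> k))\<^sup>2) \<le> (R * norm \<psi>)\<^sup>2"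
    by (simp add: power2_eq_square mult_ac)
qed

text \<open>Needed for kernels decaying only like \<open>1/j\<close>, which are not summable.\<close>

lemma convolution_l2_l1:
  fixes x :: "nat \<Rightarrow> complex"
  assumes a: "(\<lambda>j. (cmod (a j))\<^sup>2) summable_on UNIV" and x: "summable (\<lambda>k. cmod (x k))"
  shows "summable (\<lambda>k. cmod (a (int n - int k) * x k))"
    "summable (\<lambda>n. (cmod (\<Sum>k. a (int n - int k) * x k))\<^sup>2)"
proof -
  define R where "R = infsum (\<lambda>j. (cmod (a j))\<^sup>2) UNIV"
  define S where "S = (\<Sum>k. cmod (x k))"
  have R: "(\<Sum>n<m. (cmod (a (int n - int k)))\<^sup>2) \<le> R" for k m
    unfolding R_def by (rule sum_le_infsum_reindex[OF a]) (auto simp: inj_on_def)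
  have R0: "0 \<le> R" using R[of 0 0] by simp
  have S: "(\<Sum>k<m. cmod (x k)) \<le> S" for m
    unfolding S_def by (intro sum_le_suminf x) auto
  have sq: "(cmod (a (int n - int k) * x k))\<^sup>2
      \<le> cmod (x k) * ((cmod (a (int n - int k)))\<^sup>2 * cmod (x k))" for n k
    by (simp add: norm_mult power2_eq_square mult_ac)
  have cols: "(\<Sum>n<m. (cmod (a (int n - int k)))\<^sup>2 * cmod (x k)) \<le> R * cmod (x k)" for m k
    unfolding sum_distrib_right[symmetric] by (intro mult_right_mono R) simp
  have tot: "(\<Sum>k<m. R * cmod (x k)) \<le> R * S" for m
    unfolding sum_distrib_left[symmetric] by (intro mult_left_mono S R0)
  note * = schur_test[OF sq _ _ S cols tot]
  show "summable (\<lambda>k. cmod (a (int n - int k) * x k))" by (rule *(1)) auto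
  show "summable (\<lambda>n. (cmod (\<Sum>k. a (int n - int k) * x k))\<^sup>2)"
    by (rule summableI_nonneg_bounded[where x = "S * (R * S)"]) (use *(2) in auto)
qed

lemma coord_toeplitz:
  assumes "(\<lambda>j. cmod (fourier_coeff f j)) summable_on UNIV"
  shows "n \<noteq> 0 \<Longrightarrow> coord (toeplitz f \<psi>) n =
      (\<Sum>\<^sub>\<infinity>k\<in>{1..}. fourier_coeff f (int n - int k) * coord \<psi> k)" (is "_ \<Longrightarrow> _ = ?s n")
    and "n \<noteq> 0 \<Longrightarrow> coord (toeplitz f \<psi>) n = (\<Sum>k. fourier_coeff f (int n - int k) * coord \<psi> k)"
    and "norm (toeplitz f \<psi>) \<le> infsum (\<lambda>j. cmod (fourier_coeff f j)) UNIV * norm \<psi>"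
proof -
  let ?p = "\<lambda>n k. fourier_coeff f (int n - int k) * coord \<psi> k"
  let ?R = "infsum (\<lambda>j. cmod (fourier_coeff f j)) UNIV"
  have R0: "0 \<le> ?R" by (rule infsum_nonneg) simp
  note conv = convolution_l1_l2[OF assms, where \<psi> = \<psi>]
  have eq: "?s n = (\<Sum>k. ?p n k)" for n
  proof -
    have "?s n = infsum (?p n) UNIV"
      by (rule infsum_cong_neutral) (auto simp: not_le)
    also have "\<dots> = (\<Sum>k. ?p n k)"
      by (rule infsumI norm_summable_imp_has_sum conv summable_sums summable_norm_cancel)+
    finally show ?thesis .
  qed
  define t where "t n = (if n = 0 then 0 else ?s n)" for n
  have t_eq: "t n = (if n = 0 then 0 else (\<Sum>k. ?p n k))" for n by (simp only: t_def eq)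
  have part: "(\<Sum>n<N. (cmod (t n))\<^sup>2) \<le> (?R * norm \<psi>)\<^sup>2" for N
    by (rule order_trans[OF _ conv(2)[of N]]) (auto intro!: sum_mono simp: t_eq)
  have sm: "summable (\<lambda>n. (cmod (t n))\<^sup>2)"
    by (rule summableI_nonneg_bounded[OF _ part]) simp
  have ct: "coord (toeplitz f \<psi>) = t"
    unfolding toeplitz_def t_def[symmetric] by (rule coord_Abs[OF _ sm]) (simp add: t_def)
  show "n \<noteq> 0 \<Longrightarrow> coord (toeplitz f \<psi>) n = ?s n" by (simp add: ct t_def)
  show "n \<noteq> 0 \<Longrightarrow> coord (toeplitz f \<psi>) n = (\<Sum>k. ?p n k)" by (simp add: ct t_eq)
  show "norm (toeplitz f \<psi>) \<le> ?R * norm \<psi>"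
  proof (rule power2_le_imp_le)
    show "(norm (toeplitz f \<psi>))\<^sup>2 \<le> (?R * norm \<psi>)\<^sup>2"
      unfolding power2_norm_l2 ct by (rule suminf_le_const[OF sm part])
  qed (use R0 in simp)
qed

lemma summable_toeplitz_row:
  assumes "(\<lambda>j. cmod (fourier_coeff f j)) summable_on UNIV"
  shows "summable (\<lambda>k. fourier_coeff f (int n - int k) * coord \<psi> k)"
  by (rule summable_norm_cancel[OF convolution_l1_l2(1)[OF assms]])

lemma bounded_clinear_toeplitz:
  assumes "(\<lambda>j. cmod (fourier_coeff f j)) summable_on UNIV"
  shows "bounded_clinear (toeplitz f)"
proof (rule bounded_clinearI)
  note coord = coord_toeplitz(2)[OF assms] and sm = summable_toeplitz_row[OF assms]
  show "toeplitz f (\<phi> + \<psi>) = toeplitz f \<phi> + toeplitz f \<psi>" for \<phi> \<psi>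
  proof (rule l2_eqI)
    show "coord (toeplitz f (\<phi> + \<psi>)) n = coord (toeplitz f \<phi> + toeplitz f \<psi>) n" for n
      by (cases "n = 0") (simp_all add: coord suminf_add[OF sm sm] ring_distribs)
  qed
  show "toeplitz f (c *\<^sub>C \<psi>) = c *\<^sub>C toeplitz f \<psi>" for c \<psi>
  proof (rule l2_eqI)
    show "coord (toeplitz f (c *\<^sub>C \<psi>)) n = coord (c *\<^sub>C toeplitz f \<psi>) n" for n
      by (cases "n = 0") (simp_all add: coord suminf_mult[OF sm] mult.left_commute[of _ c])
  qed
  show "norm (toeplitz f \<psi>) \<le> infsum (\<lambda>j. cmod (fourier_coeff f j)) UNIV * norm \<psi>" for \<psi>
    by (rule coord_toeplitz(3)[OF assms])
qed

lemma coord_toeplitz_unit_vec: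
  assumes "(\<lambda>j. cmod (fourier_coeff f j)) summable_on UNIV" "k \<noteq> 0" "n \<noteq> 0"
  shows "coord (toeplitz f (unit_vec n)) k = fourier_coeff f (int k - int n)"
proof -
  have "coord (toeplitz f (unit_vec n)) k =
      (\<Sum>i\<in>{n}. fourier_coeff f (int k - int i) * coord (unit_vec n) i)"
    unfolding coord_toeplitz(2)[OF assms(1,2)]
    by (rule suminf_finite) (auto simp: coord_unit_vec)
  then show ?thesis using assms(3) by (simp add: coord_unit_vec)
qed

text \<open>Truncation reduces the symmetry of a bounded operator to that of its matrix.\<close>

lemma symmetric_op_unit_vec:
  assumes B: "bounded_clinear B"
    and sym: "\<And>n k. n \<noteq> 0 \<Longrightarrow> k \<noteq> 0 \<Longrightarrow> cnj (coord (B (unit_vec n)) k) = coord (B (unit_vec k)) n"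
  shows "symmetric_op B"
proof -
  interpret B: bounded_linear B using bounded_clinearD(1)[OF B] .
  have u0: "unit_vec 0 = 0" by (rule l2_eqI) (simp add: coord_unit_vec)
  have e: "cinner (B (unit_vec n)) (unit_vec k) = cinner (unit_vec n) (B (unit_vec k))" for n k
    using sym[of n k]
    by (cases "n = 0"; cases "k = 0")
      (simp_all add: u0 B.zero cinner_unit_vec cnj_cinner[of "unit_vec k", symmetric])
  have fin: "cinner (B (truncate N \<phi>)) (truncate N \<psi>) = cinner (truncate N \<phi>) (B (truncate N \<psi>))" for N \<phi> \<psi>
    unfolding truncate_def B.sum bounded_bilinear.sum_left[OF bounded_bilinear_cinner]
      bounded_bilinear.sum_right[OF bounded_bilinear_cinner]
    by (simp add: bounded_clinearD(4)[OF B] e)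
  have "cinner (B \<phi>) \<psi> = cinner \<phi> (B \<psi>)" for \<phi> \<psi>
  proof (rule LIMSEQ_unique)
    show "(\<lambda>N. cinner (B (truncate N \<phi>)) (truncate N \<psi>)) \<longlonglongrightarrow> cinner (B \<phi>) \<psi>"
      by (intro tendsto_cinner B.tendsto truncate_tendsto)
    show "(\<lambda>N. cinner (B (truncate N \<phi>)) (truncate N \<psi>)) \<longlonglongrightarrow> cinner \<phi> (B \<psi>)"
      unfolding fin by (intro tendsto_cinner B.tendsto truncate_tendsto)
  qed
  then show ?thesis by (simp add: symmetric_op_def)
qed

lemma symmetric_op_toeplitz:
  fixes g :: "real \<Rightarrow> real"
  assumes "(\<lambda>j. cmod (fourier_coeff (\<lambda>\<theta>. of_real (g \<theta>)) j)) summable_on UNIV"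
    and "continuous_on {0..2 * pi} g"
  shows "symmetric_op (toeplitz (\<lambda>\<theta>. of_real (g \<theta>)))"
proof (rule symmetric_op_unit_vec[OF bounded_clinear_toeplitz[OF assms(1)]])
  fix n k :: nat assume "n \<noteq> 0" "k \<noteq> 0"
  then show "cnj (coord (toeplitz (\<lambda>\<theta>. of_real (g \<theta>)) (unit_vec n)) k) =
      coord (toeplitz (\<lambda>\<theta>. of_real (g \<theta>)) (unit_vec k)) n"
    using fourier_coeff_minus[OF assms(2), of "int k - int n"]
    by (simp add: coord_toeplitz_unit_vec[OF assms(1)])
qed

text \<open>By \<open>2\<bar>x\<bar> \<le> k\<^sup>-\<^sup>2 + k\<^sup>2\<bar>x\<bar>\<^sup>2\<close>.\<close>

lemma dom_X_l1:
  assumes "\<psi> \<in> dom_X"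
  shows "summable (\<lambda>k. cmod (coord \<psi> k))"
proof (rule summable_comparison_test)
  show "summable (\<lambda>k. inverse (real k ^ 2) + (real k)\<^sup>2 * (cmod (coord \<psi> k))\<^sup>2)"
    using assms unfolding dom_X_def by (intro summable_add inverse_power_summable) auto
  have "cmod (coord \<psi> k) \<le> inverse (real k ^ 2) + (real k)\<^sup>2 * (cmod (coord \<psi> k))\<^sup>2" for k
  proof (cases "k = 0")
    case False
    have "0 \<le> (inverse (real k) - real k * cmod (coord \<psi> k))\<^sup>2" by simp
    also have "\<dots> = inverse (real k ^ 2) + (real k)\<^sup>2 * (cmod (coord \<psi> k))\<^sup>2 - 2 * cmod (coord \<psi> k)"
      using False by (simp add: power2_diff power_mult_distrib power_inverse)
    finally have "2 * cmod (coord \<psi> k) \<le> inverse (real k ^ 2) + (real k)\<^sup>2 * (cmod (coord \<psi> k))\<^sup>2"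
      by simp
    then show ?thesis using norm_ge_zero[of "coord \<psi> k"] by linarith
  qed simp
  then show "\<exists>N. \<forall>k\<ge>N. norm (cmod (coord \<psi> k)) \<le> inverse (real k ^ 2) + (real k)\<^sup>2 * (cmod (coord \<psi> k))\<^sup>2"
    by simp
qed

text \<open>Writing \<open>n = k + (n - k)\<close> in \<open>n \<Sum>\<^sub>k a (n - k) \<psi>\<^sub>k\<close> shows that the commutator with \<open>X\<close> has the kernel
  \<open>j * a j\<close>. This kernel need not define a bounded operator: it is enough that it maps the given
  \<open>\<psi>\<close> to a vector \<open>\<eta>\<close> of \<open>l\<^sup>2\<close>.\<close>

lemma X_op_toeplitz:
  assumes a: "(\<lambda>j. cmod (fourier_coeff f j)) summable_on UNIV" and \<psi>: "\<psi> \<in> dom_X"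
    and \<eta>: "\<And>n. n \<noteq> 0 \<Longrightarrow> (\<lambda>k. of_int (int n - int k) * fourier_coeff f (int n - int k) * coord \<psi> k) sums coord \<eta> n"
  shows "toeplitz f \<psi> \<in> dom_X" "X_op (toeplitz f \<psi>) = toeplitz f (X_op \<psi>) + \<eta>"
proof -
  have c: "coord (toeplitz f (X_op \<psi>) + \<eta>) n = of_nat n * coord (toeplitz f \<psi>) n" for n
  proof (cases "n = 0")
    case False
    let ?a = "\<lambda>k. fourier_coeff f (int n - int k)"
    have "(\<lambda>k. of_nat n * (?a k * coord \<psi> k) - ?a k * coord (X_op \<psi>) k) sums
       (of_nat n * coord (toeplitz f \<psi>) n - coord (toeplitz f (X_op \<psi>)) n)"
      unfolding coord_toeplitz(2)[OF a False]
      by (intro sums_diff sums_mult summable_sums summable_toeplitz_row a)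
    moreover have "of_nat n * (?a k * coord \<psi> k) - ?a k * coord (X_op \<psi>) k =
        of_int (int n - int k) * ?a k * coord \<psi> k" for k
      by (simp add: coord_X_op[OF \<psi>] algebra_simps)
    ultimately have "of_nat n * coord (toeplitz f \<psi>) n - coord (toeplitz f (X_op \<psi>)) n = coord \<eta> n"
      using sums_unique2[OF \<eta>[OF False]] by simp
    then show ?thesis by (simp add: algebra_simps)
  qed simp
  show "toeplitz f \<psi> \<in> dom_X" "X_op (toeplitz f \<psi>) = toeplitz f (X_op \<psi>) + \<eta>"
    by (rule dom_XI[OF c])+
qed

lemma summable_on_int_inverse_square: "(\<lambda>j :: int. 1 / (1 + \<bar>real_of_int j\<bar>)\<^sup>2) summable_on UNIV"
proof -
  let ?u = "\<lambda>j :: int. 1 / (1 + \<bar>real_of_int j\<bar>)\<^sup>2"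
  have "summable (\<lambda>n. inverse (real n ^ 2))" by (rule inverse_power_summable) simp
  then have "summable (\<lambda>n. inverse (real (Suc n) ^ 2))"
    by (simp only: summable_Suc_iff[of "\<lambda>n. inverse (real n ^ 2)"])
  then have nat: "(\<lambda>n. 1 / (1 + real n)\<^sup>2) summable_on UNIV"
    by (intro norm_summable_imp_summable_on) (simp add: divide_inverse add.commute)
  have "?u summable_on range int"
    using nat summable_on_reindex[of int UNIV ?u] by (simp add: o_def)
  moreover have neg: "?u summable_on range (\<lambda>n. - int n)"
    using nat summable_on_reindex[of "\<lambda>n. - int n" UNIV ?u] by (simp add: o_def inj_def)
  ultimately have "?u summable_on (range int \<union> (range (\<lambda>n. - int n) - range int))"
    by (intro summable_on_Un_disjoint) (auto intro: summable_on_subset_banach[OF neg])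
  moreover have "range int \<union> (range (\<lambda>n. - int n) - range int) = UNIV"
    using int_cases2 by blast
  ultimately show ?thesis by simp
qed

section \<open>Commutators of Toeplitz operators\<close>

lemma abs_summable_convolution:
  fixes a b :: "int \<Rightarrow> complex"
  assumes "(\<lambda>j. cmod (a j)) summable_on UNIV" "(\<lambda>j. cmod (b j)) summable_on UNIV"
  shows "(\<lambda>m. cmod (a (k - m) * b (m - n))) summable_on UNIV"
proof (rule Infinite_Sum.abs_summable_on_comparison_test')
  let ?R = "infsum (\<lambda>j. cmod (b j)) UNIV"
  have "bij_betw (\<lambda>m. k - m) UNIV (UNIV :: int set)"
    by (rule bij_betwI[of _ _ _ "\<lambda>m. k - m"]) auto
  then show "(\<lambda>m. cmod (a (k - m)) * ?R) summable_on UNIV"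
    using assms(1) summable_on_reindex_bij_betw[of "\<lambda>m. k - m" UNIV UNIV "\<lambda>j. cmod (a j)"]
    by (intro summable_on_cmult_left) simp
  fix m
  have "cmod (b (m - n)) \<le> ?R"
    using finite_sum_le_infsum[OF assms(2), of "{m - n}"] by simp
  then show "cmod (a (k - m) * b (m - n)) \<le> cmod (a (k - m)) * ?R"
    by (simp add: norm_mult mult_left_mono)
qed

text \<open>Over all integers the two products have the same sum, by the reflection \<open>m \<mapsto> k + n - m\<close>. Hence the
  difference of the sums over the half line is, up to sign, the difference over its complement.\<close>

lemma half_line_convolution_commutator:
  fixes a b :: "int \<Rightarrow> complex"
  assumes a: "(\<lambda>j. cmod (a j)) summable_on UNIV" and b: "(\<lambda>j. cmod (b j)) summable_on UNIV"
  shows "infsum (\<lambda>m. b (k - m) * a (m - n)) {1..} - infsum (\<lambda>m. a (k - m) * b (m - n)) {1..} =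
    infsum (\<lambda>m. a (k - m) * b (m - n)) {..0} - infsum (\<lambda>m. b (k - m) * a (m - n)) {..0}"
proof -
  have split: "infsum g UNIV = infsum g {1..} + infsum g {..0}"
    if "(\<lambda>m. cmod (g m)) summable_on UNIV" for g :: "int \<Rightarrow> complex"
  proof -
    have "g summable_on UNIV" using that by (rule abs_summable_summable)
    then have "infsum g ({1..} \<union> {..0}) = infsum g {1..} + infsum g {..0}"
      by (intro infsum_Un_disjoint) (auto intro: summable_on_subset_banach)
    moreover have "{1..} \<union> {..0} = (UNIV :: int set)" by auto
    ultimately show ?thesis by simp
  qed
  have "infsum (\<lambda>m. b (k - m) * a (m - n)) UNIV = infsum (\<lambda>m. a (k - m) * b (m - n)) UNIV"
    by (rule infsum_reindex_bij_witness[of _ "\<lambda>m. k + n - m" "\<lambda>m. k + n - m"]) (auto simp: algebra_simps)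
  then show ?thesis
    unfolding split[OF abs_summable_convolution[OF a b]] split[OF abs_summable_convolution[OF b a]]
    by (simp add: algebra_simps)
qed

lemma convolution_tail_bound:
  fixes a b :: "int \<Rightarrow> complex"
  assumes a: "(\<lambda>j. cmod (a j)) summable_on UNIV" and b: "(\<lambda>j. cmod (b j)) summable_on UNIV"
    and bound: "\<And>m. m \<le> 0 \<Longrightarrow> cmod (a (k - m) * b (m - n)) \<le> c * (1 / (1 + \<bar>real_of_int m\<bar>)\<^sup>2)"
    and c: "0 \<le> c"
  shows "cmod (infsum (\<lambda>m. a (k - m) * b (m - n)) {..0})
    \<le> c * infsum (\<lambda>j :: int. 1 / (1 + \<bar>real_of_int j\<bar>)\<^sup>2) UNIV"
proof -
  let ?u = "\<lambda>j :: int. 1 / (1 + \<bar>real_of_int j\<bar>)\<^sup>2"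
  have u: "?u summable_on {..0}"
    using summable_on_int_inverse_square by (rule summable_on_subset_banach) simp
  have p: "(\<lambda>m. a (k - m) * b (m - n)) summable_on {..0}"
    by (rule summable_on_subset_banach[OF abs_summable_summable[OF abs_summable_convolution[OF a b]]]) simp
  have "cmod (infsum (\<lambda>m. a (k - m) * b (m - n)) {..0}) \<le> c * infsum ?u {..0}"
    by (rule norm_infsum_le[OF has_sum_infsum[OF p] has_sum_cmult_right[OF has_sum_infsum[OF u]]])
      (rule bound, simp)
  also have "\<dots> \<le> c * infsum ?u UNIV"
    by (intro mult_left_mono c infsum_mono2 u summable_on_int_inverse_square) auto
  finally show ?thesis .
qed

text \<open>Division by zero being zero, the bound at \<open>k = 0\<close> says \<open>x 0 = 0\<close>, as \<open>l2\<close> requires, and the series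
  of the \<open>1/k\<^sup>2\<close> may start at 0.\<close>

lemma inverse_decay_l2:
  assumes x: "\<And>k. cmod (x k) \<le> c / real k"
  obtains \<eta> where "coord \<eta> = x" "norm \<eta> \<le> c * sqrt (\<Sum>k. inverse (real k ^ 2))"
proof -
  have s: "summable (\<lambda>k. inverse (real k ^ 2))" by (rule inverse_power_summable) simp
  have c: "0 \<le> c" using order_trans[OF norm_ge_zero x[of 1]] by simp
  have le: "(cmod (x k))\<^sup>2 \<le> c\<^sup>2 * inverse (real k ^ 2)" for k
    using power_mono[OF x[of k], of 2] by (simp add: divide_inverse power_mult_distrib power_inverse)
  have "summable (\<lambda>k. c\<^sup>2 * inverse (real k ^ 2))" by (rule summable_mult[OF s])
  then have sm: "summable (\<lambda>k. (cmod (x k))\<^sup>2)"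
    by (rule summable_comparison_test'[where N = 0]) (simp add: le)
  have cx: "coord (Abs_l2 x) = x" using x[of 0] by (intro coord_Abs sm) simp
  have "(\<Sum>k. (cmod (x k))\<^sup>2) \<le> c\<^sup>2 * (\<Sum>k. inverse (real k ^ 2))"
    unfolding suminf_mult[OF s, symmetric] by (intro suminf_le le sm summable_mult s)
  then have "norm (Abs_l2 x) \<le> sqrt (c\<^sup>2 * (\<Sum>k. inverse (real k ^ 2)))"
    unfolding norm_l2_def cx by simp
  also have "\<dots> = c * sqrt (\<Sum>k. inverse (real k ^ 2))" using c by (simp add: real_sqrt_mult)
  finally show ?thesis using that[OF cx] by simp
qed

text \<open>The entry of \<open>D\<close> at \<open>(k, n)\<close> is a sum over \<open>m \<le> 0\<close> of products of coefficients at \<open>k + \<bar>m\<bar>\<close> and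
  \<open>n + \<bar>m\<bar>\<close>. With the decay exponents 3 and 2, each product is at most a multiple of
  \<open>k\<^sup>-\<^sup>1 n\<^sup>-\<^sup>2 (1 + \<bar>m\<bar>)\<^sup>-\<^sup>2\<close>, for either order of the two symbols: two powers go to \<open>n\<close>,
  one goes to \<open>k\<close>, and the remaining two make the sum over \<open>m\<close> converge.\<close>

lemma toeplitz_commutator_decay:
  fixes f g :: "real \<Rightarrow> complex"
  defines "D \<equiv> \<lambda>\<psi>. toeplitz g (toeplitz f \<psi>) - toeplitz f (toeplitz g \<psi>)"
  assumes f: "(\<lambda>j. cmod (fourier_coeff f j)) summable_on UNIV"
    and g: "(\<lambda>j. cmod (fourier_coeff g j)) summable_on UNIV"
    and df: "\<And>j. cmod (fourier_coeff f j) \<le> K / (1 + \<bar>real_of_int j\<bar>) ^ 3" and K: "0 \<le> K"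
    and dg: "\<And>j. cmod (fourier_coeff g j) \<le> L / (1 + \<bar>real_of_int j\<bar>) ^ 2" and L: "0 \<le> L"
  obtains M where "\<And>n. n \<noteq> 0 \<Longrightarrow> norm (D (unit_vec n)) \<le> M / (real n)\<^sup>2"
proof -
  let ?f = "fourier_coeff f" and ?g = "fourier_coeff g"
  define Z where "Z = infsum (\<lambda>j :: int. 1 / (1 + \<bar>real_of_int j\<bar>)\<^sup>2) UNIV"
  define E where "E = sqrt (\<Sum>k. inverse (real k ^ 2))"
  have half: "coord (toeplitz h (toeplitz h' (unit_vec n))) k =
      infsum (\<lambda>m. fourier_coeff h (int k - m) * fourier_coeff h' (m - int n)) {1..}"
    if h: "(\<lambda>j. cmod (fourier_coeff h j)) summable_on UNIV"
      and h': "(\<lambda>j. cmod (fourier_coeff h' j)) summable_on UNIV" and nk: "n \<noteq> 0" "k \<noteq> 0" for h h' n k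
  proof -
    have "coord (toeplitz h (toeplitz h' (unit_vec n))) k =
      (\<Sum>\<^sub>\<infinity>m\<in>{1..}. fourier_coeff h (int k - int m) * coord (toeplitz h' (unit_vec n)) m)"
      by (rule coord_toeplitz(1)[OF h nk(2)])
    also have "\<dots> = (\<Sum>\<^sub>\<infinity>m\<in>{1..}. fourier_coeff h (int k - int m) * fourier_coeff h' (int m - int n))"
      by (intro infsum_cong) (simp add: coord_toeplitz_unit_vec[OF h' _ nk(1)])
    also have "\<dots> = infsum (\<lambda>m. fourier_coeff h (int k - m) * fourier_coeff h' (m - int n)) {1..}"
      by (rule infsum_reindex_bij_betw, rule bij_betwI[of _ _ _ nat]) auto
    finally show ?thesis .
  qed
  have entry: "cmod (coord (D (unit_vec n)) k) \<le> (2 * (K * L * Z / (real n)\<^sup>2)) / real k" if n: "n \<noteq> 0" for n k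
  proof (cases "k = 0")
    case False
    let ?c = "K * L / (real n ^ 2 * real k)"
    have KL: "0 \<le> ?c" using K L by simp
    have pos: "real n \<ge> 1" "real k \<ge> 1" using n False by simp_all
    have shift: "1 + \<bar>real_of_int (int k - m)\<bar> = real k + (1 + \<bar>real_of_int m\<bar>)"
      "1 + \<bar>real_of_int (m - int n)\<bar> = real n + (1 + \<bar>real_of_int m\<bar>)" if "m \<le> 0" for m :: int
      using that by simp_all
    have "cmod (?f (int k - m) * ?g (m - int n)) \<le> ?c * (1 / (1 + \<bar>real_of_int m\<bar>)\<^sup>2)" if m: "m \<le> 0" for m
    proof -
      define s where "s = 1 + \<bar>real_of_int m\<bar>"
      have s: "1 \<le> s" by (simp add: s_def)
      have "real k * s\<^sup>2 \<le> (real k + s) * (real k + s)\<^sup>2"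
        using s pos by (intro mult_mono power_mono) auto
      then have 1: "real k * s\<^sup>2 \<le> (real k + s) ^ 3" by (simp add: power3_eq_cube power2_eq_square)
      have 2: "real n ^ 2 \<le> (real n + s) ^ 2" using s by (intro power_mono) auto
      have "cmod (?f (int k - m) * ?g (m - int n)) \<le> K / (real k + s) ^ 3 * (L / (real n + s) ^ 2)"
        unfolding norm_mult using df[of "int k - m"] dg[of "m - int n"] K s
        unfolding shift[OF m] s_def[symmetric] by (intro mult_mono) auto
      also have "\<dots> \<le> K / (real k * s\<^sup>2) * (L / real n ^ 2)"
        using s pos K L 1 2 by (intro mult_mono divide_left_mono) auto
      also have "\<dots> = ?c * (1 / s\<^sup>2)" by simp
      finally show ?thesis by (simp add: s_def)
    qed
    then have F: "cmod (infsum (\<lambda>m. ?f (int k - m) * ?g (m - int n)) {..0}) \<le> ?c * Z"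
      unfolding Z_def by (intro convolution_tail_bound f g KL)
    have "cmod (?g (int k - m) * ?f (m - int n)) \<le> ?c * (1 / (1 + \<bar>real_of_int m\<bar>)\<^sup>2)" if m: "m \<le> 0" for m
    proof -
      define s where "s = 1 + \<bar>real_of_int m\<bar>"
      have s: "1 \<le> s" by (simp add: s_def)
      have "real k * s \<le> (real k + s) * (real k + s)"
        using s pos by (intro mult_mono) auto
      then have 1: "real k * s \<le> (real k + s) ^ 2" by (simp add: power2_eq_square)
      have "(real n)\<^sup>2 * s \<le> (real n + s)\<^sup>2 * (real n + s)"
        using s pos by (intro mult_mono power_mono) auto
      then have 2: "(real n)\<^sup>2 * s \<le> (real n + s) ^ 3" by (simp add: power3_eq_cube power2_eq_square)
      have "cmod (?g (int k - m) * ?f (m - int n)) \<le> L / (real k + s) ^ 2 * (K / (real n + s) ^ 3)"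
        unfolding norm_mult using dg[of "int k - m"] df[of "m - int n"] L s
        unfolding shift[OF m] s_def[symmetric] by (intro mult_mono) auto
      also have "\<dots> \<le> L / (real k * s) * (K / ((real n)\<^sup>2 * s))"
        using s pos K L 1 2 by (intro mult_mono divide_left_mono) auto
      also have "\<dots> = ?c * (1 / s\<^sup>2)" by (simp add: power2_eq_square mult_ac)
      finally show ?thesis by (simp add: s_def)
    qed
    then have G: "cmod (infsum (\<lambda>m. ?g (int k - m) * ?f (m - int n)) {..0}) \<le> ?c * Z"
      unfolding Z_def by (intro convolution_tail_bound f g KL)
    have "coord (D (unit_vec n)) k = infsum (\<lambda>m. ?f (int k - m) * ?g (m - int n)) {..0}
        - infsum (\<lambda>m. ?g (int k - m) * ?f (m - int n)) {..0}"
      unfolding D_def coord_diff half[OF g f n False] half[OF f g n False]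
      by (rule half_line_convolution_commutator[OF f g])
    then have "cmod (coord (D (unit_vec n)) k) \<le> ?c * Z + ?c * Z"
      using norm_triangle_le_diff[OF add_mono[OF F G]] by simp
    also have "\<dots> = (2 * (K * L * Z / (real n)\<^sup>2)) / real k" by (simp add: mult_ac)
    finally show ?thesis .
  qed simp
  have "norm (D (unit_vec n)) \<le> (2 * K * L * Z * E) / (real n)\<^sup>2" if n: "n \<noteq> 0" for n
  proof -
    obtain \<eta> where "coord \<eta> = coord (D (unit_vec n))" "norm \<eta> \<le> (2 * (K * L * Z / (real n)\<^sup>2)) * E"
      using inverse_decay_l2[of "coord (D (unit_vec n))", OF entry[OF n]] unfolding E_def by auto
    then show ?thesis by (simp add: coord_inject mult_ac)
  qed
  then show ?thesis by (rule that)
qed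

text \<open>Skew symmetry turns the decay of the columns \<open>D (unit_vec n)\<close> into decay of the coordinates of
  \<open>D \<psi>\<close>, which are then \<open>O(n\<^sup>-\<^sup>2)\<close>; multiplied by \<open>n\<close> they are still square summable.\<close>

lemma X_op_smoothing:
  assumes D: "bounded_clinear D" and skew: "\<And>\<phi> \<psi>. cinner (D \<phi>) \<psi> = - cinner \<phi> (D \<psi>)"
    and M: "\<And>n. n \<noteq> 0 \<Longrightarrow> norm (D (unit_vec n)) \<le> M / (real n)\<^sup>2"
  shows "D \<psi> \<in> dom_X" "bounded_clinear (\<lambda>\<psi>. X_op (D \<psi>))"
proof -
  define E where "E = sqrt (\<Sum>k. inverse (real k ^ 2))"
  have entry: "cmod (of_nat n * coord (D \<psi>) n) \<le> (M * norm \<psi>) / real n" for n \<psi>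
  proof (cases "n = 0")
    case False
    have "coord (D \<psi>) n = - cinner (D (unit_vec n)) \<psi>" by (simp add: skew cinner_unit_vec)
    then have "cmod (coord (D \<psi>) n) \<le> norm (D (unit_vec n)) * norm \<psi>" by (simp add: cmod_cinner_le)
    also have "\<dots> \<le> M / (real n)\<^sup>2 * norm \<psi>" by (intro mult_right_mono M False) simp
    finally show ?thesis using False by (simp add: norm_mult field_simps power2_eq_square)
  qed simp
  have "D \<psi> \<in> dom_X \<and> norm (X_op (D \<psi>)) \<le> M * norm \<psi> * E" for \<psi>
  proof -
    obtain \<eta> where \<eta>: "coord \<eta> = (\<lambda>n. of_nat n * coord (D \<psi>) n)" "norm \<eta> \<le> (M * norm \<psi>) * E"
      using inverse_decay_l2[of "\<lambda>n. of_nat n * coord (D \<psi>) n", OF entry] unfolding E_def by auto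
    then have "coord \<eta> n = of_nat n * coord (D \<psi>) n" for n by simp
    from dom_XI[OF this] \<eta>(2) show ?thesis by simp
  qed
  then have d: "D \<psi> \<in> dom_X" "norm (X_op (D \<psi>)) \<le> (M * E) * norm \<psi>" for \<psi> by (auto simp: mult_ac)
  then show "D \<psi> \<in> dom_X" by simp
  show "bounded_clinear (\<lambda>\<psi>. X_op (D \<psi>))"
    by (rule bounded_clinearI[where K = "M * E"])
      (simp_all add: bounded_clinearD[OF D] X_op_add X_op_scaleC d)
qed

section \<open>Commutator forms of unbounded operators\<close>

lemma bounded_sesquilinearI:
  assumes "\<And>\<phi> \<phi>' \<psi>. q (\<phi> + \<phi>') \<psi> = q \<phi> \<psi> + q \<phi>' \<psi>" "\<And>\<phi> \<psi> \<psi>'. q \<phi> (\<psi> + \<psi>') = q \<phi> \<psi> + q \<phi> \<psi>'"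
    and C: "\<And>c \<phi> \<psi>. q (c *\<^sub>C \<phi>) \<psi> = cnj c * q \<phi> \<psi>" "\<And>c \<phi> \<psi>. q \<phi> (c *\<^sub>C \<psi>) = c * q \<phi> \<psi>"
    and K: "\<And>\<phi> \<psi>. cmod (q \<phi> \<psi>) \<le> norm \<phi> * norm \<psi> * K"
  shows "bounded_sesquilinear q"
proof -
  have "q (r *\<^sub>R \<phi>) \<psi> = r *\<^sub>R q \<phi> \<psi>" "q \<phi> (r *\<^sub>R \<psi>) = r *\<^sub>R q \<phi> \<psi>" for r \<phi> \<psi>
    using C(1)[of "of_real r" \<phi> \<psi>] C(2)[of \<phi> "of_real r" \<psi>]
    by (simp_all add: scaleC_of_real scaleR_conv_of_real)
  then have "bounded_bilinear q" using assms K by unfold_locales auto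
  then show ?thesis using C by (simp add: bounded_sesquilinear_def)
qed

lemma bounded_sesquilinearD:
  assumes "bounded_sesquilinear q"
  shows "bounded_bilinear q" "q (c *\<^sub>C \<phi>) \<psi> = cnj c * q \<phi> \<psi>" "q \<phi> (c *\<^sub>C \<psi>) = c * q \<phi> \<psi>"
  using assms by (simp_all add: bounded_sesquilinear_def)

lemma bounded_sesquilinear_lincomb:
  assumes p: "bounded_sesquilinear p" and q: "bounded_sesquilinear q"
  shows "bounded_sesquilinear (\<lambda>\<phi> \<psi>. a * p \<phi> \<psi> + b * q \<phi> \<psi>)"
proof -
  interpret p: bounded_bilinear p using p by (rule bounded_sesquilinearD)
  interpret q: bounded_bilinear q using q by (rule bounded_sesquilinearD)
  obtain K where K: "\<And>\<phi> \<psi>. cmod (p \<phi> \<psi>) \<le> norm \<phi> * norm \<psi> * K" using p.bounded by blast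
  obtain L where L: "\<And>\<phi> \<psi>. cmod (q \<phi> \<psi>) \<le> norm \<phi> * norm \<psi> * L" using q.bounded by blast
  show ?thesis
  proof (rule bounded_sesquilinearI[where K = "cmod a * K + cmod b * L"])
    fix \<phi> \<psi>
    have "cmod (a * p \<phi> \<psi> + b * q \<phi> \<psi>) \<le> cmod a * cmod (p \<phi> \<psi>) + cmod b * cmod (q \<phi> \<psi>)"
      by (metis norm_mult norm_triangle_ineq)
    also have "\<dots> \<le> cmod a * (norm \<phi> * norm \<psi> * K) + cmod b * (norm \<phi> * norm \<psi> * L)"
      by (intro add_mono mult_left_mono K L) auto
    finally show "cmod (a * p \<phi> \<psi> + b * q \<phi> \<psi>) \<le> norm \<phi> * norm \<psi> * (cmod a * K + cmod b * L)"
      by (simp add: algebra_simps)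
  qed (simp_all add: p.add_left p.add_right q.add_left q.add_right bounded_sesquilinearD[OF p]
      bounded_sesquilinearD[OF q] algebra_simps)
qed

lemma bounded_sesquilinear_cinner:
  assumes B: "bounded_clinear B" and C: "bounded_clinear C"
  shows "bounded_sesquilinear (\<lambda>\<phi> \<psi>. cinner (B \<phi>) (C \<psi>))"
  using bounded_bilinear.comp[OF bounded_bilinear_cinner bounded_clinearD(1)[OF B] bounded_clinearD(1)[OF C]]
  by (simp add: bounded_sesquilinear_def bounded_clinearD(4)[OF B] bounded_clinearD(4)[OF C])

lemma bounded_clinear_ident: "bounded_clinear (\<lambda>\<psi>. \<psi>)"
  by (simp add: bounded_clinear_def)

lemma commutator_form_add:
  assumes B: "commutator_form A B p" and C: "commutator_form A C q"
  shows "commutator_form A (\<lambda>\<psi>. B \<psi> + C \<psi>) (\<lambda>\<phi> \<psi>. p \<phi> \<psi> + q \<phi> \<psi>)"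
proof -
  have "bounded_sesquilinear (\<lambda>\<phi> \<psi>. p \<phi> \<psi> + q \<phi> \<psi>)"
    using bounded_sesquilinear_lincomb[of p q 1 1] B C by (simp add: commutator_form_def)
  moreover have "cinner \<phi>' (B \<psi> + C \<psi>) - cinner \<phi> (B \<psi>' + C \<psi>') = p \<phi> \<psi> + q \<phi> \<psi>"
    if "(\<phi>, \<phi>') \<in> A" "(\<psi>, \<psi>') \<in> A" for \<phi> \<phi>' \<psi> \<psi>'
  proof -
    have "cinner \<phi>' (B \<psi>) - cinner \<phi> (B \<psi>') = p \<phi> \<psi>" "cinner \<phi>' (C \<psi>) - cinner \<phi> (C \<psi>') = q \<phi> \<psi>"
      using B C that unfolding commutator_form_def by fast+
    then show ?thesis by (simp add: cinner_add_right algebra_simps)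
  qed
  ultimately show ?thesis unfolding commutator_form_def by fast
qed

text \<open>Both sides of the defining identity are continuous in the graph norm, so it suffices to verify it
  on a core.\<close>

lemma commutator_form_closure:
  assumes B: "bounded_clinear B" and A: "commutator_form A B q"
  shows "commutator_form (closure A) B q"
  unfolding commutator_form_def
proof (intro conjI ballI, safe)
  show q: "bounded_sesquilinear q" using A by (simp add: commutator_form_def)
  interpret q: bounded_bilinear q using q by (rule bounded_sesquilinearD)
  interpret B: bounded_linear B using B by (rule bounded_clinearD)
  fix \<phi> \<phi>' \<psi> \<psi>' assume "(\<phi>, \<phi>') \<in> closure A" "(\<psi>, \<psi>') \<in> closure A"
  then obtain x y where x: "\<And>n. x n \<in> A" "x \<longlonglongrightarrow> (\<phi>, \<phi>')" and y: "\<And>n. y n \<in> A" "y \<longlonglongrightarrow> (\<psi>, \<psi>')"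
    unfolding closure_sequential by blast
  note lim = tendsto_fst[OF x(2)] tendsto_snd[OF x(2)] tendsto_fst[OF y(2)] tendsto_snd[OF y(2)]
  have eq: "cinner (snd (x n)) (B (fst (y n))) - cinner (fst (x n)) (B (snd (y n))) = q (fst (x n)) (fst (y n))" for n
    using A x(1)[of n] y(1)[of n] unfolding commutator_form_def by (cases "x n"; cases "y n") fastforce
  have "(\<lambda>n. cinner (snd (x n)) (B (fst (y n))) - cinner (fst (x n)) (B (snd (y n))))
      \<longlonglongrightarrow> cinner \<phi>' (B \<psi>) - cinner \<phi> (B \<psi>')"
    using lim by (auto intro!: tendsto_diff tendsto_cinner B.tendsto)
  moreover have "(\<lambda>n. q (fst (x n)) (fst (y n))) \<longlonglongrightarrow> q \<phi> \<psi>"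
    using lim by (auto intro!: q.tendsto)
  ultimately show "cinner \<phi>' (B \<psi>) - cinner \<phi> (B \<psi>') = q \<phi> \<psi>"
    unfolding eq by (rule LIMSEQ_unique)
qed

text \<open>Existence is the Riesz representation of the form, and uniqueness is the density of the domain,
  which contains the unit vectors and all truncations.\<close>

lemma ad_commutator_form:
  assumes q: "commutator_form A B q" and dom: "dom_X \<subseteq> Domain A"
  shows "bounded_clinear (ad A B)" "commutator_form A B (\<lambda>\<phi> \<psi>. cinner \<phi> (ad A B \<psi>))"
proof -
  let ?P = "\<lambda>C. bounded_clinear C \<and> commutator_form A B (\<lambda>\<phi> \<psi>. cinner \<phi> (C \<psi>))"
  obtain C where C: "bounded_clinear C" "\<And>\<phi> \<psi>. cinner \<phi> (C \<psi>) = q \<phi> \<psi>"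
    using riesz_representation q unfolding commutator_form_def by blast
  have "?P C" using q C by simp
  moreover have "C' = C" if C': "?P C'" for C'
  proof
    fix \<psi>
    have on_dom: "C' \<psi> = C \<psi>" if \<psi>: "\<psi> \<in> dom_X" for \<psi>
    proof (rule l2_eqI)
      fix n
      have "unit_vec n \<in> dom_X"
        by (rule dom_XI[of "of_nat n *\<^sub>C unit_vec n"]) (simp add: coord_unit_vec)
      then obtain \<phi>' \<psi>' where "(unit_vec n, \<phi>') \<in> A" "(\<psi>, \<psi>') \<in> A" using dom \<psi> by blast
      then have "cinner (unit_vec n) (C' \<psi>) = cinner (unit_vec n) (C \<psi>)"
        using C' \<open>?P C\<close> unfolding commutator_form_def by fastforce
      then show "coord (C' \<psi>) n = coord (C \<psi>) n" by (simp add: cinner_unit_vec)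
    qed
    show "C' \<psi> = C \<psi>"
    proof (rule LIMSEQ_unique)
      show "(\<lambda>N. C (truncate N \<psi>)) \<longlonglongrightarrow> C \<psi>"
        by (intro bounded_linear.tendsto[OF bounded_clinearD(1)[OF C(1)]] truncate_tendsto)
      have "(\<lambda>N. C' (truncate N \<psi>)) \<longlonglongrightarrow> C' \<psi>"
        using C' by (intro bounded_linear.tendsto[OF bounded_clinearD(1)[of C'] truncate_tendsto]) simp
      then show "(\<lambda>N. C (truncate N \<psi>)) \<longlonglongrightarrow> C' \<psi>" by (simp add: on_dom truncate_dom_X)
    qed
  qed
  ultimately have "?P (ad A B)" unfolding ad_def by (rule theI[where P = ?P])
  then show "bounded_clinear (ad A B)" "commutator_form A B (\<lambda>\<phi> \<psi>. cinner \<phi> (ad A B \<psi>))" by auto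
qed

section \<open>Toeplitz operators with smooth real symbols\<close>

lemma C_torus_abs_summable:
  assumes "C_torus k f" "2 \<le> k"
  shows "(\<lambda>j. cmod (fourier_coeff (\<lambda>\<theta>. of_real (f \<theta>)) j)) summable_on UNIV"
proof -
  obtain K where K: "\<And>n. cmod (fourier_coeff (\<lambda>\<theta>. of_real (f \<theta>)) n) \<le> K / (1 + \<bar>of_int n\<bar>) ^ k" "K \<ge> 0"
    using fourier_coeff_decay[OF assms(1)] by blast
  show ?thesis
  proof (rule Infinite_Sum.abs_summable_on_comparison_test')
    show "(\<lambda>j :: int. K * (1 / (1 + \<bar>real_of_int j\<bar>)\<^sup>2)) summable_on UNIV"
      by (intro summable_on_cmult_right summable_on_int_inverse_square)
    fix j :: int
    have "(1 + \<bar>real_of_int j\<bar>)\<^sup>2 \<le> (1 + \<bar>real_of_int j\<bar>) ^ k"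
      by (rule power_increasing[OF assms(2)]) simp
    then have "K / (1 + \<bar>real_of_int j\<bar>) ^ k \<le> K / (1 + \<bar>real_of_int j\<bar>)\<^sup>2"
      by (intro divide_left_mono K) (auto intro!: mult_pos_pos zero_less_power)
    then show "cmod (fourier_coeff (\<lambda>\<theta>. of_real (f \<theta>)) j) \<le> K * (1 / (1 + \<bar>real_of_int j\<bar>)\<^sup>2)"
      using K(1)[of j] by simp
  qed
qed

lemma C_torus_toeplitz:
  assumes "C_torus k f" "2 \<le> k"
  shows "bounded_clinear (toeplitz (\<lambda>\<theta>. of_real (f \<theta>)))" "symmetric_op (toeplitz (\<lambda>\<theta>. of_real (f \<theta>)))"
  using C_torus_abs_summable[OF assms] continuous_on_subset[OF C_torus_continuous[OF assms(1)]]
  by (auto intro: bounded_clinear_toeplitz symmetric_op_toeplitz)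

lemma toeplitz_X_commutator:
  assumes f: "C_torus (Suc k) f" "2 \<le> k" and \<psi>: "\<psi> \<in> dom_X"
  defines "T \<equiv> toeplitz (\<lambda>\<theta>. of_real (f \<theta>))" and "T' \<equiv> toeplitz (\<lambda>\<theta>. of_real (deriv f \<theta>))"
  shows "T \<psi> \<in> dom_X" "X_op (T \<psi>) = T (X_op \<psi>) + (- \<i>) *\<^sub>C T' \<psi>"
proof -
  have a: "(\<lambda>j. cmod (fourier_coeff (\<lambda>\<theta>. of_real (f \<theta>)) j)) summable_on UNIV"
    using f(2) by (intro C_torus_abs_summable[OF f(1)]) simp
  have a': "(\<lambda>j. cmod (fourier_coeff (\<lambda>\<theta>. of_real (deriv f \<theta>)) j)) summable_on UNIV"
    using f(2) by (rule C_torus_abs_summable[OF C_torus_Suc(1)[OF f(1)]])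
  have s: "(\<lambda>k. of_int (int n - int k) * fourier_coeff (\<lambda>\<theta>. of_real (f \<theta>)) (int n - int k) * coord \<psi> k)
      sums coord ((- \<i>) *\<^sub>C T' \<psi>) n" if n: "n \<noteq> 0" for n
  proof -
    have "(\<lambda>k. (- \<i>) * (fourier_coeff (\<lambda>\<theta>. of_real (deriv f \<theta>)) (int n - int k) * coord \<psi> k))
        sums ((- \<i>) * coord (T' \<psi>) n)"
      unfolding T'_def coord_toeplitz(2)[OF a' n]
      by (intro sums_mult summable_sums summable_toeplitz_row a')
    moreover have "(- \<i>) * (fourier_coeff (\<lambda>\<theta>. of_real (deriv f \<theta>)) (int n - int k) * coord \<psi> k) =
        of_int (int n - int k) * fourier_coeff (\<lambda>\<theta>. of_real (f \<theta>)) (int n - int k) * coord \<psi> k" for k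
      unfolding fourier_coeff_deriv[OF f(1)] by (simp add: mult.assoc[symmetric])
    ultimately show ?thesis by simp
  qed
  show "T \<psi> \<in> dom_X"
    unfolding T_def by (rule X_op_toeplitz(1)[OF a \<psi> s])
  show "X_op (T \<psi>) = T (X_op \<psi>) + (- \<i>) *\<^sub>C T' \<psi>"
    unfolding T_def by (rule X_op_toeplitz(2)[OF a \<psi> s])
qed

text \<open>The commutator with \<open>X\<close> has a kernel of size \<open>1/j\<close>. It is square summable, and vectors in the
  domain of \<open>X\<close> are summable, so it maps them into \<open>l\<^sup>2\<close>. This is what makes the term
  \<open>X_op (T' \<psi>)\<close> in \<open>A_graph\<close> meaningful for a symbol that is only twice differentiable.\<close>

lemma toeplitz_dom_X:
  assumes f: "C_torus 2 f" and \<psi>: "\<psi> \<in> dom_X"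
  shows "toeplitz (\<lambda>\<theta>. of_real (f \<theta>)) \<psi> \<in> dom_X"
proof -
  let ?a = "fourier_coeff (\<lambda>\<theta>. of_real (f \<theta>))"
  define c where "c j = of_int j * ?a j" for j
  obtain K where K: "\<And>n. cmod (?a n) \<le> K / (1 + \<bar>of_int n\<bar>) ^ 2" "K \<ge> 0"
    using fourier_coeff_decay[OF f] by blast
  have cK: "cmod (c j) \<le> K / (1 + \<bar>real_of_int j\<bar>)" for j
  proof -
    have "cmod (c j) \<le> (1 + \<bar>real_of_int j\<bar>) * (K / (1 + \<bar>real_of_int j\<bar>) ^ 2)"
      unfolding c_def norm_mult by (intro mult_mono K) auto
    then show ?thesis by (simp add: power2_eq_square add_nonneg_eq_0_iff)
  qed
  have "(\<lambda>j. cmod ((c j)\<^sup>2)) summable_on UNIV"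
  proof (rule Infinite_Sum.abs_summable_on_comparison_test')
    show "(\<lambda>j :: int. K\<^sup>2 * (1 / (1 + \<bar>real_of_int j\<bar>)\<^sup>2)) summable_on UNIV"
      by (intro summable_on_cmult_right summable_on_int_inverse_square)
    show "cmod ((c j)\<^sup>2) \<le> K\<^sup>2 * (1 / (1 + \<bar>real_of_int j\<bar>)\<^sup>2)" for j
      using power_mono[OF cK[of j], of 2] by (simp add: norm_power power_divide)
  qed
  then have c2: "(\<lambda>j. (cmod (c j))\<^sup>2) summable_on UNIV" by (simp add: norm_power)
  note conv = convolution_l2_l1[OF c2 dom_X_l1[OF \<psi>]]
  define x where "x n = (if n = 0 then 0 else \<Sum>k. c (int n - int k) * coord \<psi> k)" for n
  have "summable (\<lambda>n. (cmod (x n))\<^sup>2)"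
    by (rule summable_comparison_test'[OF conv(2), where N = 0]) (simp add: x_def)
  then have x: "coord (Abs_l2 x) = x" by (intro coord_Abs) (simp_all add: x_def)
  have "(\<lambda>k. of_int (int n - int k) * ?a (int n - int k) * coord \<psi> k) sums coord (Abs_l2 x) n"
    if "n \<noteq> 0" for n
    using summable_sums[OF summable_norm_cancel[OF conv(1)[of n]]] that by (simp add: x x_def c_def)
  then show ?thesis
    by (rule X_op_toeplitz(1)[OF C_torus_abs_summable[OF f order.refl] \<psi>])
qed

lemma dom_X_subset_Domain_A_graph: "dom_X \<subseteq> Domain (A_graph g)"
  unfolding A_graph_def Let_def
  by (rule order_trans[OF _ Domain_mono[OF closure_subset]]) auto

lemma A_graphI:
  "\<psi> \<in> dom_X \<Longrightarrow> (\<psi>, (1/2) *\<^sub>R (toeplitz (\<lambda>\<theta>. of_real (g \<theta>)) (X_op \<psi>)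
    + X_op (toeplitz (\<lambda>\<theta>. of_real (g \<theta>)) \<psi>))) \<in> A_graph g"
  unfolding A_graph_def Let_def by (rule subsetD[OF closure_subset]) blast

text \<open>On the domain of \<open>X\<close>, inserting \<open>XT = TX - iT'\<close> gives
  \<open>\<langle>A\<phi>, T\<psi>\<rangle> - \<langle>\<phi>, TA\<psi>\<rangle> = (\<langle>X\<phi>, D\<psi>\<rangle> - \<langle>D\<phi>, X\<psi>\<rangle>)/2 - i\<langle>T'\<phi>, T'\<psi>\<rangle>\<close> with \<open>D = [T', T]\<close>. As \<open>D\<close>
  maps into the domain of \<open>X\<close>, the factor \<open>X\<close> can be moved onto it, and \<open>XD\<close> is bounded.\<close>

lemma toeplitz_A_commutator_form:
  assumes f: "C_torus 3 f"
  obtains q where "commutator_form (A_graph (deriv f)) (toeplitz (\<lambda>\<theta>. of_real (f \<theta>))) q"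
proof -
  define T where "T = toeplitz (\<lambda>\<theta>. of_real (f \<theta>))"
  define T' where "T' = toeplitz (\<lambda>\<theta>. of_real (deriv f \<theta>))"
  define D where "D \<psi> = T' (T \<psi>) - T (T' \<psi>)" for \<psi>
  have f3: "C_torus (Suc 2) f" using f by (simp add: numeral_3_eq_3)
  note f' = C_torus_Suc(1)[OF f3]
  have T: "bounded_clinear T" "symmetric_op T" unfolding T_def by (rule C_torus_toeplitz[OF f]; simp)+
  have T': "bounded_clinear T'" "symmetric_op T'" unfolding T'_def by (rule C_torus_toeplitz[OF f']; simp)+
  have XT: "T \<psi> \<in> dom_X" "X_op (T \<psi>) = T (X_op \<psi>) + (- \<i>) *\<^sub>C T' \<psi>" if "\<psi> \<in> dom_X" for \<psi>
    using toeplitz_X_commutator[OF f3 order.refl that] by (simp_all add: T_def T'_def)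
  have XT': "T' \<psi> \<in> dom_X" if "\<psi> \<in> dom_X" for \<psi>
    unfolding T'_def by (rule toeplitz_dom_X[OF f' that])
  have symT: "cinner (T \<phi>) \<psi> = cinner \<phi> (T \<psi>)" for \<phi> \<psi> using T(2) by (simp add: symmetric_op_def)
  have symT': "cinner (T' \<phi>) \<psi> = cinner \<phi> (T' \<psi>)" for \<phi> \<psi> using T'(2) by (simp add: symmetric_op_def)
  have skew: "cinner (D \<phi>) \<psi> = - cinner \<phi> (D \<psi>)" for \<phi> \<psi>
    by (simp add: D_def cinner_diff_left cinner_diff_right symT symT')
  have D: "bounded_clinear D"
    unfolding bounded_clinear_def D_def
    by (intro conjI allI bounded_linear_sub bounded_linear_compose[OF bounded_clinearD(1)[OF T(1)]]
        bounded_linear_compose[OF bounded_clinearD(1)[OF T'(1)]] bounded_clinearD(1) T T')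
      (simp add: bounded_clinearD(4)[OF T(1)] bounded_clinearD(4)[OF T'(1)] scaleC_diff_right)
  obtain K where K: "\<And>n. cmod (fourier_coeff (\<lambda>\<theta>. of_real (f \<theta>)) n) \<le> K / (1 + \<bar>of_int n\<bar>) ^ 3" "K \<ge> 0"
    using fourier_coeff_decay[OF f] by blast
  obtain L where L: "\<And>n. cmod (fourier_coeff (\<lambda>\<theta>. of_real (deriv f \<theta>)) n) \<le> L / (1 + \<bar>of_int n\<bar>) ^ 2" "L \<ge> 0"
    using fourier_coeff_decay[OF f'] by blast
  obtain M where M: "\<And>n. n \<noteq> 0 \<Longrightarrow> norm (D (unit_vec n)) \<le> M / (real n)\<^sup>2"
    using toeplitz_commutator_decay[OF C_torus_abs_summable[OF f] C_torus_abs_summable[OF f' order.refl] K L]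
    unfolding D_def T_def T'_def by auto
  note XD = X_op_smoothing[OF D skew M]
  \<comment> \<open>The coefficients 1 and \<open>- 1\<close> are spelled out to match \<open>bounded_sesquilinear_lincomb\<close>.\<close>
  define q where "q \<phi> \<psi> = (1/2) * (1 * cinner \<phi> (X_op (D \<psi>)) + (- 1) * cinner (X_op (D \<phi>)) \<psi>)
      + (- \<i>) * cinner (T' \<phi>) (T' \<psi>)" for \<phi> \<psi>
  have "bounded_sesquilinear q"
    unfolding q_def
    by (intro bounded_sesquilinear_lincomb bounded_sesquilinear_cinner bounded_clinear_ident XD T')
  moreover have "cinner ((1/2) *\<^sub>R (T' (X_op \<phi>) + X_op (T' \<phi>))) (T \<psi>)
      - cinner \<phi> (T ((1/2) *\<^sub>R (T' (X_op \<psi>) + X_op (T' \<psi>)))) = q \<phi> \<psi>"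
    if \<phi>: "\<phi> \<in> dom_X" and \<psi>: "\<psi> \<in> dom_X" for \<phi> \<psi>
  proof -
    have "cinner \<phi> (T (T' (X_op \<psi>) + X_op (T' \<psi>))) = cinner (T \<phi>) (T' (X_op \<psi>)) + cinner (T \<phi>) (X_op (T' \<psi>))"
      by (simp add: symT[symmetric] cinner_add_right)
    also have "cinner (T \<phi>) (T' (X_op \<psi>)) = cinner (T' (T \<phi>)) (X_op \<psi>)" by (simp add: symT')
    also have "cinner (T \<phi>) (X_op (T' \<psi>)) = cinner (X_op (T \<phi>)) (T' \<psi>)"
      by (rule X_op_symmetric[symmetric]) (simp_all add: XT(1) XT' \<phi> \<psi>)
    also have "\<dots> = cinner (X_op \<phi>) (T (T' \<psi>)) + \<i> * cinner (T' \<phi>) (T' \<psi>)"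
      by (simp add: XT \<phi> cinner_add_left symT)
    finally have r: "cinner \<phi> (T (T' (X_op \<psi>) + X_op (T' \<psi>))) =
      cinner (T' (T \<phi>)) (X_op \<psi>) + (cinner (X_op \<phi>) (T (T' \<psi>)) + \<i> * cinner (T' \<phi>) (T' \<psi>))" .
    have "cinner (T' (X_op \<phi>) + X_op (T' \<phi>)) (T \<psi>) = cinner (X_op \<phi>) (T' (T \<psi>)) + cinner (T' \<phi>) (X_op (T \<psi>))"
      by (simp add: cinner_add_left symT' X_op_symmetric XT XT' \<phi> \<psi>)
    also have "cinner (T' \<phi>) (X_op (T \<psi>)) = cinner (T (T' \<phi>)) (X_op \<psi>) - \<i> * cinner (T' \<phi>) (T' \<psi>)"
      by (simp add: XT \<psi> cinner_add_right symT cinner_diff_right scaleC_minus_left cinner_minus_right)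
    finally have l: "cinner (T' (X_op \<phi>) + X_op (T' \<phi>)) (T \<psi>) =
      cinner (X_op \<phi>) (T' (T \<psi>)) + (cinner (T (T' \<phi>)) (X_op \<psi>) - \<i> * cinner (T' \<phi>) (T' \<psi>))" .
    have "cinner (T' (X_op \<phi>) + X_op (T' \<phi>)) (T \<psi>) - cinner \<phi> (T (T' (X_op \<psi>) + X_op (T' \<psi>)))
      = cinner (X_op \<phi>) (D \<psi>) - cinner (D \<phi>) (X_op \<psi>) - 2 * \<i> * cinner (T' \<phi>) (T' \<psi>)"
      unfolding l r D_def cinner_diff_left cinner_diff_right by (simp add: algebra_simps)
    also have "\<dots> = cinner \<phi> (X_op (D \<psi>)) - cinner (X_op (D \<phi>)) \<psi> - 2 * \<i> * cinner (T' \<phi>) (T' \<psi>)"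
      by (simp add: X_op_symmetric XD(1) \<phi> \<psi>)
    finally show ?thesis
      unfolding bounded_clinearD(5)[OF T(1)] cinner_scaleR_right cinner_scaleR_left q_def
      by (simp add: scaleR_conv_of_real right_diff_distrib[symmetric] algebra_simps)
  qed
  ultimately have "commutator_form {(\<psi>, (1/2) *\<^sub>R (T' (X_op \<psi>) + X_op (T' \<psi>))) |\<psi>. \<psi> \<in> dom_X} T q"
    unfolding commutator_form_def by blast
  from commutator_form_closure[OF T(1) this] show ?thesis
    by (intro that) (simp add: A_graph_def Let_def T_def T'_def)
qed

section \<open>Exponential series\<close>

lemma summable_exp_series:
  fixes v :: "nat \<Rightarrow> 'a::banach"
  assumes v: "\<And>k. norm (v k) \<le> K * M ^ k"
  shows "summable (\<lambda>k. (t ^ k / fact k) *\<^sub>R v k)"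
proof (rule summable_norm_cancel, rule summable_comparison_test)
  show "\<exists>N. \<forall>k\<ge>N. norm (norm ((t ^ k / fact k) *\<^sub>R v k)) \<le> K * ((\<bar>t\<bar> * M) ^ k /\<^sub>R fact k)"
  proof (intro exI allI impI)
    fix k
    have "norm (norm ((t ^ k / fact k) *\<^sub>R v k)) = \<bar>t\<bar> ^ k / fact k * norm (v k)"
      by (simp add: power_abs)
    also have "\<dots> \<le> \<bar>t\<bar> ^ k / fact k * (K * M ^ k)" by (intro mult_left_mono v) simp
    finally show "norm (norm ((t ^ k / fact k) *\<^sub>R v k)) \<le> K * ((\<bar>t\<bar> * M) ^ k /\<^sub>R fact k)"
      by (simp add: power_mult_distrib field_simps)
  qed
  show "summable (\<lambda>k. K * ((\<bar>t\<bar> * M) ^ k /\<^sub>R fact k))"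
    by (intro summable_mult summable_exp_generic)
qed

text \<open>Termwise differentiation, the differentiated series being dominated by an exponential series on
  every bounded interval.\<close>

lemma exp_series_has_vector_derivative:
  fixes v :: "nat \<Rightarrow> 'a::banach"
  assumes v: "\<And>k. norm (v k) \<le> K * M ^ k"
  shows "((\<lambda>t. \<Sum>k. (t ^ k / fact k) *\<^sub>R v k) has_vector_derivative
    (\<Sum>k. (t ^ k / fact k) *\<^sub>R v (Suc k))) (at t)"
proof -
  define R where "R = \<bar>t\<bar> + 1"
  define S where "S = ball (0 :: real) R"
  define d where "d k s = (real k * s ^ (k - 1) / fact k) *\<^sub>R v k" for k and s :: real
  have d_Suc: "d (Suc k) s = (s ^ k / fact k) *\<^sub>R v (Suc k)" for k s
    unfolding d_def by (simp add: fact_Suc del: of_nat_Suc)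
  have v': "norm (v (Suc k)) \<le> (K * M) * M ^ k" for k using v[of "Suc k"] by (simp add: mult_ac)
  have d0: "d 0 s = 0" for s by (simp add: d_def)
  have dsum: "(\<Sum>k. d k s) = (\<Sum>k. (s ^ k / fact k) *\<^sub>R v (Suc k))" for s
  proof -
    have "summable (\<lambda>k. d k s)"
      using summable_exp_series[of "\<lambda>k. v (Suc k)", OF v', of s]
      by (subst summable_Suc_iff[symmetric]) (simp add: d_Suc)
    then show ?thesis using suminf_split_head[of "\<lambda>k. d k s"] by (simp add: d0 d_Suc)
  qed
  \<comment> \<open>The term at 0 is constant; from 1 on, the majorant is that of the shifted series.\<close>
  define W where "W k = (case k of 0 \<Rightarrow> 0 | Suc j \<Rightarrow> (K * M) * ((R * M) ^ j /\<^sub>R fact j))" for k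
  have unif: "uniform_limit S (\<lambda>n s. \<Sum>i<n. d i s) (\<lambda>s. \<Sum>i. d i s) sequentially"
  proof (rule Weierstrass_m_test)
    show "summable W"
    proof (subst summable_Suc_iff[symmetric])
      show "summable (\<lambda>j. W (Suc j))"
        unfolding W_def nat.case by (intro summable_mult summable_exp_generic)
    qed
    fix k s assume "s \<in> S"
    then have s: "\<bar>s\<bar> \<le> R" by (simp add: S_def)
    show "norm (d k s) \<le> W k"
    proof (cases k)
      case (Suc j)
      have "norm (d k s) = \<bar>s\<bar> ^ j / fact j * norm (v (Suc j))"
        by (simp add: Suc d_Suc power_abs)
      also have "\<dots> \<le> R ^ j / fact j * ((K * M) * M ^ j)"
        using s by (intro mult_mono v' divide_right_mono power_mono) (auto simp: R_def)
      also have "\<dots> = W k" by (simp add: W_def Suc power_mult_distrib field_simps)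
      finally show ?thesis .
    qed (simp add: d0 W_def)
  qed
  have "\<exists>g. \<forall>s\<in>S. (\<lambda>k. (s ^ k / fact k) *\<^sub>R v k) sums g s \<and>
      (g has_derivative (\<lambda>h. h *\<^sub>R (\<Sum>k. d k s))) (at s within S)"
  proof (rule has_derivative_series)
    show "convex S" by (simp add: S_def)
    show "((\<lambda>s. (s ^ k / fact k) *\<^sub>R v k) has_derivative (\<lambda>h. h *\<^sub>R d k s)) (at s within S)" for k s
    proof -
      have "((\<lambda>s. s ^ k / fact k) has_real_derivative real k * s ^ (k - 1) / fact k) (at s within S)"
        by (rule DERIV_cong[OF DERIV_cdivide[OF DERIV_pow]]) simp
      from has_derivative_scaleR_left[OF has_field_derivative_imp_has_derivative[OF this], of "v k"]
      show ?thesis unfolding d_def by (simp add: mult.commute)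
    qed
    show "\<forall>\<^sub>F n in sequentially. \<forall>s\<in>S. \<forall>h. norm ((\<Sum>i<n. h *\<^sub>R d i s) - h *\<^sub>R (\<Sum>k. d k s)) \<le> e * norm h"
      if "e > 0" for e :: real
      using uniform_limitD[OF unif that]
    proof eventually_elim
      case (elim n)
      show ?case
      proof (intro ballI allI)
        fix s :: real and h :: real assume "s \<in> S"
        have "norm ((\<Sum>i<n. h *\<^sub>R d i s) - h *\<^sub>R (\<Sum>k. d k s)) = \<bar>h\<bar> * dist (\<Sum>i<n. d i s) (\<Sum>k. d k s)"
          by (simp add: scaleR_sum_right[symmetric] scaleR_diff_right[symmetric] dist_norm)
        also have "\<dots> \<le> \<bar>h\<bar> * e" using elim \<open>s \<in> S\<close> by (intro mult_left_mono) auto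
        finally show "norm ((\<Sum>i<n. h *\<^sub>R d i s) - h *\<^sub>R (\<Sum>k. d k s)) \<le> e * norm h"
          by (simp add: mult.commute)
      qed
    qed
    show "(0::real) \<in> S" by (simp add: S_def R_def)
    show "(\<lambda>k. (0 ^ k / fact k) *\<^sub>R v k) sums (\<Sum>k. (0 ^ k / fact k) *\<^sub>R v k)"
      by (rule summable_sums[OF summable_exp_series[OF v]])
  qed
  then obtain g where g: "\<And>s. s \<in> S \<Longrightarrow> (\<lambda>k. (s ^ k / fact k) *\<^sub>R v k) sums g s"
    "\<And>s. s \<in> S \<Longrightarrow> (g has_derivative (\<lambda>h. h *\<^sub>R (\<Sum>k. d k s))) (at s within S)" by blast
  have t: "t \<in> S" "open S" by (auto simp: S_def R_def)
  have "(g has_vector_derivative (\<Sum>k. d k t)) (at t)"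
    using g(2)[OF t(1)] unfolding has_vector_derivative_def at_within_open[OF t] .
  then have "((\<lambda>t. \<Sum>k. (t ^ k / fact k) *\<^sub>R v k) has_vector_derivative (\<Sum>k. d k t)) (at t)"
    by (rule has_vector_derivative_transform_within_open[OF _ t(2,1)]) (rule sums_unique[OF g(1)])
  then show ?thesis by (simp only: dsum)
qed

section \<open>Growth from differential inequalities\<close>

text \<open>The functions \<open>a s - M s\<close> and then \<open>N s - (2\<bar>a 0\<bar> + C) s - M s\<^sup>2\<close> are nonincreasing. Bounding the
  increment of \<open>N\<close> by the length of the interval times the maximum of its derivative would
  give \<open>2M\<close> in place of \<open>M\<close>, hence the two steps.\<close>

lemma quadratic_growth_nonneg:
  fixes N a r a' :: "real \<Rightarrow> real"
  assumes N: "\<And>s. (N has_real_derivative 2 * a s + r s) (at s)"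
    and a: "\<And>s. (a has_real_derivative a' s) (at s)"
    and r: "\<And>s. \<bar>r s\<bar> \<le> C" and a': "\<And>s. \<bar>a' s\<bar> \<le> M" and t: "t \<ge> 0"
  shows "N t \<le> N 0 + (2 * \<bar>a 0\<bar> + C) * t + M * t\<^sup>2"
proof -
  have a_le: "a s \<le> \<bar>a 0\<bar> + M * s" if "s \<ge> 0" for s
  proof -
    have "a s - M * s \<le> a 0 - M * 0"
    proof (rule DERIV_nonpos_imp_nonincreasing[OF that])
      fix u :: real
      have "((\<lambda>s. a s - M * s) has_real_derivative a' u - M) (at u)"
        by (auto intro!: derivative_eq_intros a)
      moreover have "a' u - M \<le> 0" using a'[of u] by linarith
      ultimately show "\<exists>y. ((\<lambda>s. a s - M * s) has_real_derivative y) (at u) \<and> y \<le> 0" by blast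
    qed
    then show ?thesis by simp
  qed
  have "N t - (2 * \<bar>a 0\<bar> + C) * t - M * t\<^sup>2 \<le> N 0 - (2 * \<bar>a 0\<bar> + C) * 0 - M * 0\<^sup>2"
  proof (rule DERIV_nonpos_imp_nonincreasing[OF t])
    fix u :: real assume u: "0 \<le> u"
    have "((\<lambda>s. N s - (2 * \<bar>a 0\<bar> + C) * s - M * s\<^sup>2) has_real_derivative
        2 * a u + r u - (2 * \<bar>a 0\<bar> + C) - 2 * M * u) (at u)"
      by (auto intro!: derivative_eq_intros N)
    moreover have "2 * a u + r u - (2 * \<bar>a 0\<bar> + C) - 2 * M * u \<le> 0"
      using a_le[OF u] r[of u] by linarith
    ultimately show "\<exists>y. ((\<lambda>s. N s - (2 * \<bar>a 0\<bar> + C) * s - M * s\<^sup>2) has_real_derivative y) (at u) \<and> y \<le> 0"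
      by blast
  qed
  then show ?thesis by simp
qed

text \<open>Time reversal \<open>t \<mapsto> -t\<close> replaces \<open>a\<close> by \<open>- a (- t)\<close> and \<open>r\<close> by \<open>- r (- t)\<close>, which satisfy the same
  bounds.\<close>

lemma quadratic_growth:
  fixes N a r a' :: "real \<Rightarrow> real"
  assumes N: "\<And>s. (N has_real_derivative 2 * a s + r s) (at s)"
    and a: "\<And>s. (a has_real_derivative a' s) (at s)"
    and r: "\<And>s. \<bar>r s\<bar> \<le> C" and a': "\<And>s. \<bar>a' s\<bar> \<le> M"
  shows "N t \<le> N 0 + (2 * \<bar>a 0\<bar> + C) * \<bar>t\<bar> + M * t\<^sup>2"
proof (cases "t \<ge> 0")
  case True
  then show ?thesis using quadratic_growth_nonneg[OF assms, of t] by simp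
next
  case False
  have N': "((\<lambda>s. N (- s)) has_real_derivative 2 * (- a (- s)) + (- r (- s))) (at s)" for s
    by (rule DERIV_cong[OF DERIV_chain2[OF N DERIV_minus[OF DERIV_ident]]]) simp
  have a'': "((\<lambda>s. - a (- s)) has_real_derivative a' (- s)) (at s)" for s
    by (rule DERIV_cong[OF DERIV_minus[OF DERIV_chain2[OF a DERIV_minus[OF DERIV_ident]]]]) simp
  show ?thesis
    using quadratic_growth_nonneg[OF N' a'', of C M "- t"] False r a' by simp
qed

lemma limsup_of_quadratic_bound:
  fixes g :: "real \<Rightarrow> real"
  assumes g: "\<And>t. (g t)\<^sup>2 \<le> \<alpha> + \<beta> * \<bar>t\<bar> + M * t\<^sup>2" and "F = at_top \<or> F = at_bot"
  shows "Limsup F (\<lambda>t. ereal (g t / \<bar>t\<bar>)) \<le> ereal (sqrt M)"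
proof -
  have inf: "filterlim (\<lambda>t :: real. \<bar>t\<bar>) at_top F"
    using assms(2) filterlim_abs_real filterlim_compose[OF filterlim_abs_real filterlim_uminus_at_top_at_bot]
    by auto
  have F: "F \<noteq> bot"
    using assms(2) trivial_limit_at_top_linorder trivial_limit_at_bot_linorder by metis
  define b where "b t = sqrt (\<alpha> * (inverse \<bar>t\<bar>)\<^sup>2 + \<beta> * inverse \<bar>t\<bar> + M)" for t
  have "((\<lambda>t. inverse \<bar>t\<bar>) \<longlongrightarrow> 0) F"
    by (rule tendsto_inverse_0_at_top[OF inf])
  then have "(b \<longlongrightarrow> sqrt (\<alpha> * 0\<^sup>2 + \<beta> * 0 + M)) F"
    unfolding b_def by (intro tendsto_intros)
  then have lim: "((\<lambda>t. ereal (b t)) \<longlongrightarrow> ereal (sqrt M)) F" by simp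
  have "\<forall>\<^sub>F t in F. 0 < \<bar>t\<bar>" using inf unfolding filterlim_at_top_dense by (rule spec)
  then have "\<forall>\<^sub>F t in F. ereal (g t / \<bar>t\<bar>) \<le> ereal (b t)"
  proof eventually_elim
    case (elim t)
    have "(g t / \<bar>t\<bar>)\<^sup>2 = (g t)\<^sup>2 * (inverse \<bar>t\<bar>)\<^sup>2" by (simp add: divide_inverse power_mult_distrib)
    also have "\<dots> \<le> (\<alpha> + \<beta> * \<bar>t\<bar> + M * t\<^sup>2) * (inverse \<bar>t\<bar>)\<^sup>2"
      by (intro mult_right_mono g) simp
    also have "\<dots> = \<alpha> * (inverse \<bar>t\<bar>)\<^sup>2 + \<beta> * inverse \<bar>t\<bar> + M"
      using elim by (simp add: power2_eq_square field_simps)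
    finally show ?case unfolding b_def by (simp add: real_le_rsqrt)
  qed
  then have "Limsup F (\<lambda>t. ereal (g t / \<bar>t\<bar>)) \<le> Limsup F (\<lambda>t. ereal (b t))" by (rule Limsup_mono)
  also have "\<dots> = ereal (sqrt M)" by (rule lim_imp_Limsup[OF F lim])
  finally show ?thesis .
qed

section \<open>The evolution\<close>

definition exp_flow :: "(l2 \<Rightarrow> l2) \<Rightarrow> l2 \<Rightarrow> real \<Rightarrow> l2"
  where "exp_flow J \<phi> t = (\<Sum>k. (t ^ k / fact k) *\<^sub>R (J ^^ k) \<phi>)"

lemma op_exp_eq_exp_flow:
  assumes J: "bounded_clinear J"
  shows "op_exp (\<lambda>\<psi>. of_real t *\<^sub>C J \<psi>) \<phi> = exp_flow J \<phi> t"
proof -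
  have "((\<lambda>\<psi>. of_real t *\<^sub>C J \<psi>) ^^ k) \<phi> = t ^ k *\<^sub>R (J ^^ k) \<phi>" for k
    by (induction k) (simp_all add: scaleC_of_real bounded_clinearD(5)[OF J])
  then show ?thesis unfolding op_exp_def exp_flow_def by (simp add: divide_inverse mult.commute)
qed

lemma exp_flow_0: "exp_flow J \<phi> 0 = \<phi>"
  unfolding exp_flow_def by (subst suminf_finite[of "{0}"]) auto

text \<open>Since \<open>XJ = JX + P\<close> with \<open>P\<close> bounded, \<open>J\<close> is bounded in the graph norm of \<open>X\<close>, with constant
  \<open>M + L\<close> below. So both the exponential series and its image under \<open>X\<close> are series of the kind
  treated above, and closedness of \<open>X\<close> links them.\<close>

lemma exp_flow_dom_X:
  assumes J: "bounded_clinear J" and P: "bounded_clinear P"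
    and XJ: "\<And>\<psi>. \<psi> \<in> dom_X \<Longrightarrow> J \<psi> \<in> dom_X" "\<And>\<psi>. \<psi> \<in> dom_X \<Longrightarrow> X_op (J \<psi>) = J (X_op \<psi>) + P \<psi>"
    and \<phi>: "\<phi> \<in> dom_X"
  shows "exp_flow J \<phi> t \<in> dom_X"
    and "(exp_flow J \<phi> has_vector_derivative J (exp_flow J \<phi> t)) (at t)"
    and "((\<lambda>t. X_op (exp_flow J \<phi> t)) has_vector_derivative X_op (J (exp_flow J \<phi> t))) (at t)"
proof -
  interpret J: bounded_linear J using J by (rule bounded_clinearD)
  interpret P: bounded_linear P using P by (rule bounded_clinearD)
  define v where "v k = (J ^^ k) \<phi>" for k
  have v_Suc: "v (Suc k) = J (v k)" for k by (simp add: v_def)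
  have vX: "v k \<in> dom_X" for k by (induction k) (simp_all add: v_def \<phi> XJ)
  obtain M where M: "\<And>\<psi>. norm (J \<psi>) \<le> norm \<psi> * M" "M \<ge> 0" using J.nonneg_bounded by blast
  obtain L where L: "\<And>\<psi>. norm (P \<psi>) \<le> norm \<psi> * L" "L \<ge> 0" using P.nonneg_bounded by blast
  define C where "C = norm \<phi> + norm (X_op \<phi>)"
  have "norm (v k) + norm (X_op (v k)) \<le> C * (M + L) ^ k" for k
  proof (induction k)
    case (Suc k)
    have "norm (v (Suc k)) + norm (X_op (v (Suc k))) \<le> norm (v k) * M + (norm (X_op (v k)) * M + norm (v k) * L)"
      unfolding v_Suc XJ(2)[OF vX] by (intro add_mono M norm_triangle_le L)
    also have "\<dots> \<le> (norm (v k) + norm (X_op (v k))) * (M + L)"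
      using L(2) by (simp add: algebra_simps)
    also have "\<dots> \<le> C * (M + L) ^ k * (M + L)" by (intro mult_right_mono Suc) (use M L in simp)
    finally show ?case by (simp add: mult_ac)
  qed (simp add: v_def C_def)
  then have nv: "norm (v k) \<le> C * (M + L) ^ k" and nXv: "norm (X_op (v k)) \<le> C * (M + L) ^ k" for k
    by (meson add_increasing add_increasing2 norm_ge_zero order_trans order.refl)+
  have nv': "norm (v (Suc k)) \<le> (C * (M + L)) * (M + L) ^ k"
    and nXv': "norm (X_op (v (Suc k))) \<le> (C * (M + L)) * (M + L) ^ k" for k
    using nv[of "Suc k"] nXv[of "Suc k"] by (simp_all add: mult_ac)
  have F: "exp_flow J \<phi> = (\<lambda>t. \<Sum>k. (t ^ k / fact k) *\<^sub>R v k)" by (simp add: fun_eq_iff exp_flow_def v_def)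
  have G: "(\<Sum>k. (t ^ k / fact k) *\<^sub>R v k) \<in> dom_X"
    "X_op (\<Sum>k. (t ^ k / fact k) *\<^sub>R v k) = (\<Sum>k. (t ^ k / fact k) *\<^sub>R X_op (v k))" for t
    using X_op_suminf[of "\<lambda>k. (t ^ k / fact k) *\<^sub>R v k"] summable_exp_series[of v, OF nv]
      summable_exp_series[of "\<lambda>k. X_op (v k)", OF nXv]
    by (simp_all add: X_op_scaleR[OF vX])
  have G': "X_op (\<Sum>k. (t ^ k / fact k) *\<^sub>R v (Suc k)) = (\<Sum>k. (t ^ k / fact k) *\<^sub>R X_op (v (Suc k)))" for t
    using X_op_suminf(2)[of "\<lambda>k. (t ^ k / fact k) *\<^sub>R v (Suc k)"] summable_exp_series[of "\<lambda>k. v (Suc k)", OF nv']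
      summable_exp_series[of "\<lambda>k. X_op (v (Suc k))", OF nXv']
    by (simp add: X_op_scaleR[OF vX])
  have JF: "J (\<Sum>k. (t ^ k / fact k) *\<^sub>R v k) = (\<Sum>k. (t ^ k / fact k) *\<^sub>R v (Suc k))" for t
    unfolding J.suminf[OF summable_exp_series[of v, OF nv]] J.scaleR v_Suc ..
  show "exp_flow J \<phi> t \<in> dom_X" unfolding F by (rule G)
  show "(exp_flow J \<phi> has_vector_derivative J (exp_flow J \<phi> t)) (at t)"
    unfolding F JF by (rule exp_series_has_vector_derivative[of v, OF nv])
  show "((\<lambda>t. X_op (exp_flow J \<phi> t)) has_vector_derivative X_op (J (exp_flow J \<phi> t))) (at t)"
    unfolding F JF G G' by (rule exp_series_has_vector_derivative[of "\<lambda>k. X_op (v k)", OF nXv])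
qed

lemma exp_flow_norm:
  assumes "\<And>t. (exp_flow J \<phi> has_vector_derivative J (exp_flow J \<phi> t)) (at t)"
    and skew: "\<And>\<psi>. inner \<psi> (J \<psi>) = 0"
  shows "norm (exp_flow J \<phi> t) = norm \<phi>"
proof -
  have "((\<lambda>t. inner (exp_flow J \<phi> t) (exp_flow J \<phi> t)) has_real_derivative 0) (at t)" for t
    using bounded_bilinear.has_vector_derivative[OF bounded_bilinear_inner assms(1) assms(1), of t]
    by (simp add: has_real_derivative_iff_has_vector_derivative skew inner_commute[of "J _"])
  then have "inner (exp_flow J \<phi> t) (exp_flow J \<phi> t) = inner (exp_flow J \<phi> 0) (exp_flow J \<phi> 0)"
    by (intro DERIV_isconst_all allI)
  then show ?thesis by (simp add: exp_flow_0 norm_eq_sqrt_inner)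
qed

text \<open>On the diagonal, the form of \<open>[A, H]\<close> is \<open>-2i Im \<langle>H\<psi>, A\<psi>\<rangle>\<close>.\<close>

lemma form_bound_by_ad:
  assumes H: "symmetric_op H" and A: "(\<psi>, A\<psi>) \<in> A"
    and q: "commutator_form A H q" "dom_X \<subseteq> Domain A"
  shows "\<bar>2 * Im (cinner (H \<psi>) A\<psi>)\<bar> \<le> onorm (ad A H) * (norm \<psi>)\<^sup>2"
proof -
  note ad = ad_commutator_form[OF q]
  have "cinner \<psi> (ad A H \<psi>) = cinner A\<psi> (H \<psi>) - cinner \<psi> (H A\<psi>)"
    using ad(2) A unfolding commutator_form_def by fastforce
  also have "\<dots> = cnj (cinner (H \<psi>) A\<psi>) - cinner (H \<psi>) A\<psi>"
    using H by (simp add: cnj_cinner symmetric_op_def)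
  also have "\<dots> = - 2 * \<i> * Im (cinner (H \<psi>) A\<psi>)" by (simp add: complex_eq_iff)
  finally have "\<bar>2 * Im (cinner (H \<psi>) A\<psi>)\<bar> = cmod (cinner \<psi> (ad A H \<psi>))"
    by (simp add: norm_mult)
  also have "\<dots> \<le> norm \<psi> * norm (ad A H \<psi>)" by (rule cmod_cinner_le)
  also have "\<dots> \<le> norm \<psi> * (onorm (ad A H) * norm \<psi>)"
    by (intro mult_left_mono onorm bounded_clinearD(1) ad) simp
  finally show ?thesis by (simp add: power2_eq_square mult_ac)
qed

text \<open>With \<open>J = iH\<close> one has \<open>XJ = JX + T' + iQ\<close>, where \<open>Q = [X, V]\<close>. Hence the derivative of \<open>\<parallel>X\<psi>\<parallel>\<^sup>2\<close> is
  \<open>2a + r\<close> with \<open>a = Re \<langle>X\<psi>, T'\<psi>\<rangle>\<close> and \<open>r = -2 Im \<langle>X\<psi>, Q\<psi>\<rangle>\<close>, because \<open>J\<close> is skew. The remainder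
  \<open>r\<close> is controlled by the form of \<open>[X\<^sup>2, V]\<close>. The derivative of \<open>a\<close> is \<open>2 Re \<langle>J\<psi>, A\<psi>\<rangle>\<close>, which is
  \<open>2 Im \<langle>H\<psi>, A\<psi>\<rangle>\<close> and hence bounded by the norm of \<open>[A, H]\<close>.\<close>

lemma evolution_quadratic_bound:
  fixes f :: "real \<Rightarrow> real" and V H :: "l2 \<Rightarrow> l2" and \<phi> :: l2
  assumes f: "C_torus 3 f" and V: "bounded_clinear V" "symmetric_op V"
    and V1: "V \<in> C1 (A_graph (deriv f))" "V \<in> C1 X_graph" "V \<in> C1 (X_graph O X_graph)"
    and H: "H = (\<lambda>\<psi>. toeplitz (\<lambda>\<theta>. of_real (f \<theta>)) \<psi> + V \<psi>)"
    and \<phi>: "\<phi> \<in> dom_X"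
  obtains \<alpha> \<beta> where "\<And>t. (norm_X (op_exp (\<lambda>\<psi>. (\<i> * of_real t) *\<^sub>C H \<psi>) \<phi>))\<^sup>2
    \<le> \<alpha> + \<beta> * \<bar>t\<bar> + (onorm (ad (A_graph (deriv f)) H) * (norm \<phi>)\<^sup>2) * t\<^sup>2"
proof -
  define T where "T = toeplitz (\<lambda>\<theta>. of_real (f \<theta>))"
  define T' where "T' = toeplitz (\<lambda>\<theta>. of_real (deriv f \<theta>))"
  define A where "A \<psi> = (1/2) *\<^sub>R (T' (X_op \<psi>) + X_op (T' \<psi>))" for \<psi>
  define J where "J \<psi> = \<i> *\<^sub>C H \<psi>" for \<psi>
  have f3: "C_torus (Suc 2) f" using f by (simp add: numeral_3_eq_3)
  note f' = C_torus_Suc(1)[OF f3]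
  have T: "bounded_clinear T" "symmetric_op T" unfolding T_def by (rule C_torus_toeplitz[OF f]; simp)+
  have T': "bounded_clinear T'" "symmetric_op T'" unfolding T'_def by (rule C_torus_toeplitz[OF f']; simp)+
  have XT: "T \<psi> \<in> dom_X" "X_op (T \<psi>) = T (X_op \<psi>) + (- \<i>) *\<^sub>C T' \<psi>" if "\<psi> \<in> dom_X" for \<psi>
    using toeplitz_X_commutator[OF f3 order.refl that] by (simp_all add: T_def T'_def)
  have XT': "T' \<psi> \<in> dom_X" if "\<psi> \<in> dom_X" for \<psi>
    unfolding T'_def by (rule toeplitz_dom_X[OF f' that])
  obtain Q where Q: "bounded_clinear Q" "\<And>\<psi>. \<psi> \<in> dom_X \<Longrightarrow> V \<psi> \<in> dom_X"
      "\<And>\<psi>. \<psi> \<in> dom_X \<Longrightarrow> X_op (V \<psi>) = V (X_op \<psi>) + Q \<psi>"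
    using C1_X_commutator[OF V1(2)] by blast
  obtain C where C: "\<And>\<psi>. \<psi> \<in> dom_X \<Longrightarrow> \<bar>2 * Im (cinner (X_op \<psi>) (Q \<psi>))\<bar> \<le> C * (norm \<psi>)\<^sup>2"
    using C1_X_square_bound[OF V V1(3) Q] by blast
  have H_eq: "H \<psi> = T \<psi> + V \<psi>" for \<psi> by (simp add: H T_def)
  have Hb: "bounded_clinear H" unfolding H T_def[symmetric] by (rule bounded_clinear_add[OF T(1) V(1)])
  have Hs: "symmetric_op H"
    using T(2) V(2) by (simp add: symmetric_op_def H_eq cinner_add_left cinner_add_right)
  obtain q where q: "commutator_form (A_graph (deriv f)) H q"
  proof -
    obtain p r where "commutator_form (A_graph (deriv f)) T p" "commutator_form (A_graph (deriv f)) V r"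
      using toeplitz_A_commutator_form[OF f] V1(1) unfolding T_def C1_def by blast
    from commutator_form_add[OF this] show ?thesis by (intro that) (simp add: H T_def)
  qed
  have Jb: "bounded_clinear J" unfolding J_def by (rule bounded_clinear_scaleC[OF Hb])
  have P: "bounded_clinear (\<lambda>\<psi>. T' \<psi> + \<i> *\<^sub>C Q \<psi>)"
    by (intro bounded_clinear_add bounded_clinear_scaleC T' Q)
  have Hd: "H \<psi> \<in> dom_X" if "\<psi> \<in> dom_X" for \<psi>
    unfolding H_eq by (intro X_op_add XT Q that)
  have XJ: "J \<psi> \<in> dom_X" "X_op (J \<psi>) = J (X_op \<psi>) + (T' \<psi> + \<i> *\<^sub>C Q \<psi>)" if "\<psi> \<in> dom_X" for \<psi>
  proof -
    have "X_op (H \<psi>) = H (X_op \<psi>) + ((- \<i>) *\<^sub>C T' \<psi> + Q \<psi>)"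
      unfolding H_eq by (simp add: X_op_add XT Q that)
    then show "J \<psi> \<in> dom_X" "X_op (J \<psi>) = J (X_op \<psi>) + (T' \<psi> + \<i> *\<^sub>C Q \<psi>)"
      unfolding J_def using X_op_scaleC[OF Hd[OF that], of \<i>] by (simp_all add: scaleC_add_right)
  qed
  have skew: "inner \<psi> (J \<psi>) = 0" for \<psi>
    by (simp add: inner_l2_def J_def symmetric_op_Im[OF Hs])
  define F where "F = exp_flow J \<phi>"
  have flow: "op_exp (\<lambda>\<psi>. (\<i> * of_real t) *\<^sub>C H \<psi>) \<phi> = F t" for t
    using op_exp_eq_exp_flow[OF Jb, of t \<phi>] by (simp add: F_def J_def mult.commute)
  note dF = exp_flow_dom_X[OF Jb P XJ \<phi>, folded F_def]
  have nF: "norm (F t) = norm \<phi>" for t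
    using exp_flow_norm[OF dF(2)[unfolded F_def] skew] by (simp add: F_def)
  define N where "N t = (norm (X_op (F t)))\<^sup>2" for t
  define a where "a t = inner (X_op (F t)) (T' (F t))" for t
  define r where "r t = - 2 * Im (cinner (X_op (F t)) (Q (F t)))" for t
  define a' where "a' t = 2 * Im (cinner (H (F t)) (A (F t)))" for t
  have "(N has_real_derivative 2 * a t + r t) (at t)" for t
  proof -
    let ?x = "X_op (F t)"
    have "(N has_real_derivative inner ?x (X_op (J (F t))) + inner (X_op (J (F t))) ?x) (at t)"
      using bounded_bilinear.has_vector_derivative[OF bounded_bilinear_inner dF(3) dF(3), of t]
      by (simp add: N_def[abs_def] power2_norm_eq_inner has_real_derivative_iff_has_vector_derivative)
    moreover have "inner ?x (X_op (J (F t))) = a t + r t / 2"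
      by (simp add: XJ dF(1) inner_add_right skew a_def r_def)
        (simp add: inner_l2_def)
    ultimately show ?thesis by (simp add: inner_commute[of _ ?x])
  qed
  moreover have "(a has_real_derivative a' t) (at t)" for t
  proof -
    let ?x = "X_op (F t)" and ?y = "J (F t)"
    note d = dF(1)[of t]
    have "((\<lambda>t. T' (F t)) has_vector_derivative T' ?y) (at t)"
      by (rule bounded_linear.has_vector_derivative[OF bounded_clinearD(1)[OF T'(1)] dF(2)])
    then have "(a has_real_derivative inner ?x (T' ?y) + inner (X_op ?y) (T' (F t))) (at t)"
      using bounded_bilinear.has_vector_derivative[OF bounded_bilinear_inner dF(3)]
      by (simp add: a_def[abs_def] has_real_derivative_iff_has_vector_derivative)
    moreover have "inner ?x (T' ?y) = inner ?y (T' ?x)"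
      using T'(2) unfolding inner_l2_def symmetric_op_def by (metis inner_commute inner_l2_def)
    moreover have "inner (X_op ?y) (T' (F t)) = inner ?y (X_op (T' (F t)))"
      unfolding inner_l2_def by (subst X_op_symmetric) (simp_all add: XJ(1) XT' d)
    moreover have "inner ?y (T' ?x) + inner ?y (X_op (T' (F t))) = 2 * inner ?y (A (F t))"
      by (simp add: A_def inner_add_right)
    moreover have "2 * inner ?y (A (F t)) = a' t"
      by (simp add: inner_l2_def J_def a'_def)
    ultimately show ?thesis by simp
  qed
  moreover have "\<bar>r t\<bar> \<le> C * (norm \<phi>)\<^sup>2" for t
    using C[OF dF(1), of t] by (simp add: r_def nF)
  moreover have "\<bar>a' t\<bar> \<le> onorm (ad (A_graph (deriv f)) H) * (norm \<phi>)\<^sup>2" for t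
    using form_bound_by_ad[OF Hs A_graphI[OF dF(1)] q dom_X_subset_Domain_A_graph, of t]
    by (simp add: a'_def A_def T'_def nF)
  ultimately have growth: "N t \<le> N 0 + (2 * \<bar>a 0\<bar> + C * (norm \<phi>)\<^sup>2) * \<bar>t\<bar>
      + (onorm (ad (A_graph (deriv f)) H) * (norm \<phi>)\<^sup>2) * t\<^sup>2" for t
    by (rule quadratic_growth)
  have "(norm_X (F t))\<^sup>2 = (norm \<phi>)\<^sup>2 + N t" for t
    by (simp add: norm_X_def N_def nF)
  then show ?thesis
    using growth by (intro that[of "(norm \<phi>)\<^sup>2 + N 0" "2 * \<bar>a 0\<bar> + C * (norm \<phi>)\<^sup>2"]) (simp add: flow add.assoc)
qed

theorem proposition4p2:
  fixes f :: "real \<Rightarrow> real" and V H :: "l2 \<Rightarrow> l2" and \<phi> :: l2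
  assumes "C_torus 3 f" and "\<not> f constant_on UNIV"
    and "bounded_clinear V" and "symmetric_op V"
    and "V \<in> C1 (A_graph (deriv f))" and "V \<in> C1 X_graph" and "V \<in> C1 (X_graph O X_graph)"
    and "H = (\<lambda>\<psi>. toeplitz (\<lambda>\<theta>. of_real (f \<theta>)) \<psi> + V \<psi>)"
    and "\<phi> \<in> dom_X"
  shows "Limsup at_top (\<lambda>t :: real.
           ereal (norm_X (op_exp (\<lambda>\<psi>. (\<i> * of_real t) *\<^sub>C H \<psi>) \<phi>) / \<bar>t\<bar>))
           \<le> ereal (sqrt (onorm (ad (A_graph (deriv f)) H)) * norm \<phi>)
         \<and> Limsup at_bot (\<lambda>t :: real.
           ereal (norm_X (op_exp (\<lambda>\<psi>. (\<i> * of_real t) *\<^sub>C H \<psi>) \<phi>) / \<bar>t\<bar>))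
           \<le> ereal (sqrt (onorm (ad (A_graph (deriv f)) H)) * norm \<phi>)"
proof -
  obtain \<alpha> \<beta> where "\<And>t. (norm_X (op_exp (\<lambda>\<psi>. (\<i> * of_real t) *\<^sub>C H \<psi>) \<phi>))\<^sup>2
    \<le> \<alpha> + \<beta> * \<bar>t\<bar> + (onorm (ad (A_graph (deriv f)) H) * (norm \<phi>)\<^sup>2) * t\<^sup>2"
    using evolution_quadratic_bound[OF assms(1,3-9)] by blast
  from limsup_of_quadratic_bound[OF this] show ?thesis by (simp add: real_sqrt_mult)
qed

end
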